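(* There is a $3$-tardy c.e. set $A$ such that for all $2$-tardy c.e. sets $B$, $A \nleq_T B$.
   Context: Sets are subsets of $\omega$; $\{W_{e}\}_{e\in\omega}$ is the standard listing of the c.e. sets with standard stagewise enumeration $\{W_{e,s}\}_{s\in\omega}$ (only numbers less than $s$ belong to $W_{e,s}$). $\overline{A}=\omega\setminus A$, and $\le_T$ is Turing reducibility. $n$-c.e. sets: for $n\ge 1$, a set $X$ is $n$-c.e. iff there are c.e. sets $X_1,\dots,X_n$ such that $X=(X_1-X_2)\cup\dots\cup(X_{n-2}-X_{n-1})\cup X_n$ if $n$ is odd, and $X=(X_1-X_2)\cup\dots\cup(X_{n-1}-X_n)$ if $n$ is even. Fix an effective listing of all such presentations (sequences $W_{e_1},\dots,W_{e_n}$ of c.e. sets given by indices); $X^n_e$ denotes the $e$-th $n$-c.e. set in this listing, and $X^n_{e,s}$ denotes its stage-$s$ approximation, obtained by replacing each $W_{e_i}$ by $W_{e_i,s}$ in the formula above. $n$-tardy: let $A$ be c.e. with a computable enumeration $\{A_s\}_{s\in\omega}$. $A$ is $n$-tardy iff for every nondecreasing total computable function $p$ there is an $e$ such that $X^n_e=\overline{A}$ and, for all $x$ and all $s$, $x\in X^n_{e,s}$ implies $x\notin A_{p(s)}$. (This notion does not depend on the choice of enumeration of $A$.) *)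

theory Defs
  imports Main "HOL-Library.Nat_Bijection"
begin

text \<open>
  Oracle programs denoting partial functions from naturals to naturals. Several arguments are
  passed as one, by the pairing bijection \<^const>\<open>prod_encode\<close>. The basic functions are zero,
  successor, the two projections and the characteristic function of the oracle; the closure
  operations are pairing, composition, primitive recursion and minimization.
\<close>

datatype prog =
    PZero | PSucc | PFst | PSnd | POracle
  | PPair prog prog | PComp prog prog | PPrec prog prog | PMin prog

definition chi :: "nat set \<Rightarrow> nat \<Rightarrow> nat" where
  "chi A x = (if x \<in> A then 1 else 0)"

text \<open>
  \<open>run B s c x\<close> is the result of program \<open>c\<close> on input \<open>x\<close> with oracle \<open>B\<close> if the nested
  evaluation finishes within depth \<open>s\<close>, and \<^const>\<open>None\<close> otherwise; see
  \<open>converges_PPair\<close> and its companions below for the resulting denotations. \<open>PMin c\<close> sends the pair of \<open>a\<close> and \<open>m\<close> to the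
  least \<open>k \<ge> m\<close> for which \<open>c\<close> returns 0 on the pair of \<open>a\<close> and \<open>k\<close> (all earlier values being
  defined), so that \<open>m = 0\<close> gives the usual \<open>\<mu>\<close>-operator. Each step of the search costs one unit.
\<close>

fun run :: "nat set \<Rightarrow> nat \<Rightarrow> prog \<Rightarrow> nat \<Rightarrow> nat option" where
  "run B 0 c x = None"
| "run B (Suc s) PZero x = Some 0"
| "run B (Suc s) PSucc x = Some (Suc x)"
| "run B (Suc s) PFst x = Some (fst (prod_decode x))"
| "run B (Suc s) PSnd x = Some (snd (prod_decode x))"
| "run B (Suc s) POracle x = Some (chi B x)"
| "run B (Suc s) (PPair c d) x =
     (case run B s c x of None \<Rightarrow> None | Some y \<Rightarrow>
       (case run B s d x of None \<Rightarrow> None | Some z \<Rightarrow> Some (prod_encode (y, z))))"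
| "run B (Suc s) (PComp c d) x =
     (case run B s d x of None \<Rightarrow> None | Some y \<Rightarrow> run B s c y)"
| "run B (Suc s) (PPrec c d) x =
     (case prod_decode x of (a, m) \<Rightarrow>
       (case m of
          0 \<Rightarrow> run B s c a
        | Suc n \<Rightarrow>
            (case run B s (PPrec c d) (prod_encode (a, n)) of None \<Rightarrow> None
             | Some y \<Rightarrow> run B s d (prod_encode (a, prod_encode (n, y))))))"
| "run B (Suc s) (PMin c) x =
     (case prod_decode x of (a, m) \<Rightarrow>
       (case run B s c x of
          None \<Rightarrow> None
        | Some 0 \<Rightarrow> Some m
        | Some (Suc _) \<Rightarrow> run B s (PMin c) (prod_encode (a, Suc m))))"

definition converges :: "nat set \<Rightarrow> prog \<Rightarrow> nat \<Rightarrow> nat \<Rightarrow> bool" where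
  "converges B c x y \<longleftrightarrow> (\<exists>s. run B s c x = Some y)"

text \<open>Total functions computable from the oracle \<open>B\<close>.\<close>

definition computable_in :: "nat set \<Rightarrow> (nat \<Rightarrow> nat) \<Rightarrow> bool" where
  "computable_in B f \<longleftrightarrow> (\<exists>c. \<forall>x. converges B c x (f x))"

abbreviation computable :: "(nat \<Rightarrow> nat) \<Rightarrow> bool" where
  "computable f \<equiv> computable_in {} f"

definition turing_le :: "nat set \<Rightarrow> nat set \<Rightarrow> bool" (infix "\<le>\<^sub>T" 50) where
  "A \<le>\<^sub>T B \<longleftrightarrow> computable_in B (chi A)"

text \<open>
  Indices: an effective bijection from the naturals onto programs (see \<open>bij_decode\<close> below).
\<close>

function decode :: "nat \<Rightarrow> prog" where
  "decode e =
     (if e = 0 then PZero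
      else if e = 1 then PSucc
      else if e = 2 then PFst
      else if e = 3 then PSnd
      else if e = 4 then POracle
      else let k = (e - 5) div 4; r = (e - 5) mod 4; (a, b) = prod_decode k in
        if r = 0 then PPair (decode a) (decode b)
        else if r = 1 then PComp (decode a) (decode b)
        else if r = 2 then PPrec (decode a) (decode b)
        else PMin (decode k))"
  by pat_completeness auto

lemma prod_decode_less:
  assumes "(a, b) = prod_decode ((e - 5) div 4)" "e > 0"
  shows "a < e" "b < e"
proof -
  have "(e - 5) div 4 = prod_encode (a, b)"
    using assms(1) by (metis prod_decode_inverse)
  then have "a \<le> (e - 5) div 4" "b \<le> (e - 5) div 4"
    by (simp_all add: le_prod_encode_1 le_prod_encode_2)
  moreover have "(e - 5) div 4 < e"
    using assms(2) by linarith
  ultimately show "a < e" "b < e"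
    by simp_all
qed

termination decode
  by (relation "measure id") (auto dest: prod_decode_less)

declare decode.simps [simp del]

text \<open>\<open>W e\<close> is the domain of the partial computable function with index \<open>e\<close> (empty oracle).\<close>

definition W :: "nat \<Rightarrow> nat set" where
  "W e = {x. \<exists>y. converges {} (decode e) x y}"

definition W_stage :: "nat \<Rightarrow> nat \<Rightarrow> nat set" where
  "W_stage e s = {x. x < s \<and> run {} s (decode e) x \<noteq> None}"

definition ce :: "nat set \<Rightarrow> bool" where
  "ce A \<longleftrightarrow> (\<exists>e. A = W e)"

text \<open>
  \<open>alt_diff [X\<^sub>1, \<dots>, X\<^sub>n]\<close> is \<open>(X\<^sub>1 - X\<^sub>2) \<union> (X\<^sub>3 - X\<^sub>4) \<union> \<dots>\<close>, the last set of an odd number of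
  sets being taken as it stands.
\<close>

fun alt_diff :: "nat set list \<Rightarrow> nat set" where
  "alt_diff [] = {}"
| "alt_diff [X] = X"
| "alt_diff (X # Y # Zs) = (X - Y) \<union> alt_diff Zs"

text \<open>For \<open>n \<ge> 1\<close>, \<open>tuple n\<close> is an effective bijection from the naturals onto \<open>n\<close>-tuples.\<close>

fun tuple :: "nat \<Rightarrow> nat \<Rightarrow> nat list" where
  "tuple 0 e = []"
| "tuple (Suc 0) e = [e]"
| "tuple (Suc (Suc n)) e = fst (prod_decode e) # tuple (Suc n) (snd (prod_decode e))"

text \<open>\<open>nce n e\<close> is the \<open>e\<close>-th \<open>n\<close>-c.e. set, \<open>nce_stage n e s\<close> its stage \<open>s\<close> approximation.\<close>

definition nce :: "nat \<Rightarrow> nat \<Rightarrow> nat set" where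
  "nce n e = alt_diff (map W (tuple n e))"

definition nce_stage :: "nat \<Rightarrow> nat \<Rightarrow> nat \<Rightarrow> nat set" where
  "nce_stage n e s = alt_diff (map (\<lambda>i. W_stage i s) (tuple n e))"

text \<open>
  The stages of a computable enumeration are given by canonical indices
  (\<^const>\<open>set_encode\<close> is meaningful for finite sets only).
\<close>

definition computable_enumeration :: "(nat \<Rightarrow> nat set) \<Rightarrow> nat set \<Rightarrow> bool" where
  "computable_enumeration As A \<longleftrightarrow>
     (\<forall>s. finite (As s)) \<and> (\<forall>s. As s \<subseteq> As (Suc s)) \<and> (\<Union>s. As s) = A \<and>
     computable (\<lambda>s. set_encode (As s))"

text \<open>
  Every c.e. set has a computable enumeration, and being \<open>n\<close>-tardy does not depend on which one
  is used. The definition is meant for \<open>n \<ge> 1\<close>.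
\<close>

definition tardy :: "nat \<Rightarrow> nat set \<Rightarrow> bool" where
  "tardy n A \<longleftrightarrow>
     (\<exists>As. computable_enumeration As A \<and>
        (\<forall>p. computable p \<and> mono p \<longrightarrow>
           (\<exists>e. nce n e = - A \<and> (\<forall>x s. x \<in> nce_stage n e s \<longrightarrow> x \<notin> As (p s)))))"


lemma run_Suc: "run B s c x = Some y \<Longrightarrow> run B (Suc s) c x = Some y"
proof (induction B s c x arbitrary: y rule: run.induct)
  case (7 B s c d x)
  show ?case using 7 by (fastforce split: option.splits)
next
  case (8 B s c d x)
  show ?case using 8 by (fastforce split: option.splits)
next
  case (9 B s c d x)
  obtain a m where x: "prod_decode x = (a, m)" by (cases "prod_decode x")
  show ?case
  proof (cases m)
    case 0
    then show ?thesis using 9 x by auto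
  next
    case (Suc n)
    then obtain z where z: "run B s (PPrec c d) (prod_encode (a, n)) = Some z"
      and y: "run B s d (prod_encode (a, prod_encode (n, z))) = Some y"
      using "9.prems" x by (auto split: option.splits)
    have "run B (Suc s) (PPrec c d) (prod_encode (a, n)) = Some z"
      using "9.IH"(2)[OF x[symmetric] Suc z] by simp
    moreover have "run B (Suc s) d (prod_encode (a, prod_encode (n, z))) = Some y"
      using "9.IH"(3)[OF x[symmetric] Suc z y] by simp
    ultimately show ?thesis using x Suc
      by (simp del: run.simps add: run.simps(9)[of B "Suc s"])
  qed
next
  case (10 B s c x)
  obtain a m where x: "prod_decode x = (a, m)" by (cases "prod_decode x")
  obtain v where v: "run B s c x = Some v"
    using "10.prems" x by (auto split: option.splits)
  have v': "run B (Suc s) c x = Some v"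
    using "10.IH"(1)[OF x[symmetric] v] by simp
  show ?case
  proof (cases v)
    case 0
    then show ?thesis using x v v' "10.prems"
      by (simp del: run.simps add: run.simps(10))
  next
    case (Suc w)
    have "run B s (PMin c) (prod_encode (a, Suc m)) = Some y"
      using x v Suc "10.prems" by simp
    then have "run B (Suc s) (PMin c) (prod_encode (a, Suc m)) = Some y"
      using "10.IH"(2)[OF x[symmetric] v Suc] by simp
    then show ?thesis using x v' Suc
      by (simp del: run.simps add: run.simps(10)[of B "Suc s"])
  qed
qed auto

lemma run_mono: "run B s c x = Some y \<Longrightarrow> s \<le> t \<Longrightarrow> run B t c x = Some y"
  by (induction t rule: nat_induct) (auto simp: le_Suc_eq intro: run_Suc)

lemma converges_unique: "converges B c x y \<Longrightarrow> converges B c x z \<Longrightarrow> y = z"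
  unfolding converges_def
  by (metis nle_le option.inject run_mono)

lemma converges_iff_Suc: "converges B c x y \<longleftrightarrow> (\<exists>s. run B (Suc s) c x = Some y)"
  unfolding converges_def by (metis run_Suc)

lemma converges_PZero: "converges B PZero x y \<longleftrightarrow> y = 0"
  and converges_PSucc: "converges B PSucc x y \<longleftrightarrow> y = Suc x"
  and converges_PFst: "converges B PFst x y \<longleftrightarrow> y = fst (prod_decode x)"
  and converges_PSnd: "converges B PSnd x y \<longleftrightarrow> y = snd (prod_decode x)"
  and converges_POracle: "converges B POracle x y \<longleftrightarrow> y = chi B x"
  by (auto simp: converges_iff_Suc)

lemma run_common:
  assumes "converges B c x y" "converges B d x' y'"
  obtains s where "run B s c x = Some y" "run B s d x' = Some y'"
  using assms unfolding converges_def by (metis nle_le run_mono)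

lemma converges_PPair:
  "converges B (PPair c d) x v \<longleftrightarrow>
     (\<exists>y z. converges B c x y \<and> converges B d x z \<and> v = prod_encode (y, z))" (is "?L \<longleftrightarrow> ?R")
proof
  assume ?L
  then obtain s where "run B (Suc s) (PPair c d) x = Some v"
    unfolding converges_iff_Suc[of _ "PPair c d"] by blast
  then obtain y z where "run B s c x = Some y" "run B s d x = Some z" "v = prod_encode (y, z)"
    by (auto split: option.splits)
  then show ?R
    unfolding converges_def by blast
next
  assume ?R
  then obtain y z where "converges B c x y" "converges B d x z" and v: "v = prod_encode (y, z)"
    by blast
  then obtain s where "run B s c x = Some y" "run B s d x = Some z"
    using run_common by blast
  then have "run B (Suc s) (PPair c d) x = Some v" using v by simp
  then show ?L unfolding converges_def by blast
qed

lemma converges_PComp: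
  "converges B (PComp c d) x v \<longleftrightarrow> (\<exists>y. converges B d x y \<and> converges B c y v)" (is "?L \<longleftrightarrow> ?R")
proof
  assume ?L
  then show ?R
    unfolding converges_iff_Suc[of _ "PComp c d"]
    by (auto simp: converges_def split: option.split_asm)
next
  assume ?R
  then obtain y where "converges B d x y" "converges B c y v"
    by blast
  then obtain s where "run B s d x = Some y" "run B s c y = Some v"
    using run_common by blast
  then have "run B (Suc s) (PComp c d) x = Some v" by simp
  then show ?L unfolding converges_def by blast
qed

lemma converges_PPrec_0:
  "converges B (PPrec c d) (prod_encode (a, 0)) v \<longleftrightarrow> converges B c a v"
  unfolding converges_iff_Suc[of _ "PPrec c d"] by (simp add: converges_def)

lemma converges_PPrec_Suc:
  "converges B (PPrec c d) (prod_encode (a, Suc n)) v \<longleftrightarrow>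
     (\<exists>y. converges B (PPrec c d) (prod_encode (a, n)) y \<and>
          converges B d (prod_encode (a, prod_encode (n, y))) v)" (is "?L \<longleftrightarrow> ?R")
proof
  assume ?L
  then show ?R
    unfolding converges_iff_Suc[of _ "PPrec c d" "prod_encode (a, Suc n)"]
    by (auto simp: converges_def split: option.split_asm)
next
  assume ?R
  then obtain y where "converges B (PPrec c d) (prod_encode (a, n)) y"
    "converges B d (prod_encode (a, prod_encode (n, y))) v"
    by blast
  then obtain s where "run B s (PPrec c d) (prod_encode (a, n)) = Some y"
    "run B s d (prod_encode (a, prod_encode (n, y))) = Some v"
    using run_common by blast
  then have "run B (Suc s) (PPrec c d) (prod_encode (a, Suc n)) = Some v" by simp
  then show ?L unfolding converges_def by blast
qed

lemma converges_PMin: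
  "converges B (PMin c) (prod_encode (a, m)) k \<longleftrightarrow>
     m \<le> k \<and> converges B c (prod_encode (a, k)) 0 \<and>
     (\<forall>i. m \<le> i \<and> i < k \<longrightarrow> (\<exists>z. converges B c (prod_encode (a, i)) (Suc z)))" (is "?L \<longleftrightarrow> ?R m")
proof
  have *: "run B s (PMin c) (prod_encode (a, m)) = Some k \<Longrightarrow> ?R m" for s
  proof (induction s arbitrary: m)
    case 0
    then show ?case by simp
  next
    case (Suc s)
    then obtain v where v: "run B s c (prod_encode (a, m)) = Some v"
      by (auto split: option.splits)
    show ?case
    proof (cases v)
      case 0
      then show ?thesis using Suc.prems v by (auto simp: converges_def)
    next
      case (Suc w)
      then have "run B s (PMin c) (prod_encode (a, Suc m)) = Some k"
        using Suc.prems v by simp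
      from Suc.IH[OF this] have R: "?R (Suc m)" .
      moreover have "converges B c (prod_encode (a, m)) (Suc w)"
        using v Suc by (auto simp: converges_def)
      ultimately show ?thesis
        by (metis Suc_leD le_antisym not_less_eq_eq)
    qed
  qed
  assume ?L
  then show "?R m" using * unfolding converges_def by blast
next
  assume "?R m"
  then have "m \<le> k" "?R m" by auto
  then show ?L
  proof (induction m rule: inc_induct)
    case base
    then obtain s where "run B s c (prod_encode (a, k)) = Some 0"
      unfolding converges_def by blast
    then have "run B (Suc s) (PMin c) (prod_encode (a, k)) = Some k" by simp
    then show ?case unfolding converges_def by blast
  next
    case (step m)
    have "converges B (PMin c) (prod_encode (a, Suc m)) k"
      using step by simp
    moreover obtain z where "converges B c (prod_encode (a, m)) (Suc z)"
      using step by auto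
    ultimately obtain s where "run B s c (prod_encode (a, m)) = Some (Suc z)"
      "run B s (PMin c) (prod_encode (a, Suc m)) = Some k"
      using run_common by blast
    then have "run B (Suc s) (PMin c) (prod_encode (a, m)) = Some k" by simp
    then show ?case unfolding converges_def by blast
  qed
qed

primrec encode :: "prog \<Rightarrow> nat" where
  "encode PZero = 0"
| "encode PSucc = 1"
| "encode PFst = 2"
| "encode PSnd = 3"
| "encode POracle = 4"
| "encode (PPair c d) = 5 + 4 * prod_encode (encode c, encode d)"
| "encode (PComp c d) = 6 + 4 * prod_encode (encode c, encode d)"
| "encode (PPrec c d) = 7 + 4 * prod_encode (encode c, encode d)"
| "encode (PMin c) = 8 + 4 * encode c"

lemma decode_encode: "decode (encode c) = c"
proof (induction c)
  case (PPair c d)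
  then show ?case by (subst decode.simps) (simp add: Let_def)
next
  case (PComp c d)
  have "(Suc (4 * k)) div 4 = k" "(Suc (4 * k)) mod 4 = 1" for k :: nat by presburger+
  then show ?case using PComp by (subst decode.simps) (simp add: Let_def)
next
  case (PPrec c d)
  have "(Suc (Suc (4 * k))) div 4 = k" "(Suc (Suc (4 * k))) mod 4 = 2" for k :: nat
    by presburger+
  then show ?case using PPrec by (subst decode.simps) (simp add: Let_def)
next
  case (PMin c)
  have "(3 + 4 * k) div 4 = k" "(3 + 4 * k) mod 4 = 3" for k :: nat by presburger+
  then show ?case using PMin by (subst decode.simps) (simp add: Let_def split: prod.split)
qed (subst decode.simps, simp)+

lemma encode_decode: "encode (decode e) = e"
proof (induction e rule: less_induct)
  case (less e)
  show ?case
  proof (cases "e < 5")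
    case True
    then have "e = 0 \<or> e = 1 \<or> e = 2 \<or> e = 3 \<or> e = 4" by auto
    then show ?thesis by (subst decode.simps) auto
  next
    case False
    obtain a b where ab: "prod_decode ((e - 5) div 4) = (a, b)"
      by (cases "prod_decode ((e - 5) div 4)")
    then have k: "prod_encode (a, b) = (e - 5) div 4" by (metis prod_decode_inverse)
    have "a < e" "b < e" "(e - 5) div 4 < e"
      using prod_decode_less[OF ab[symmetric]] False by auto
    then have IH: "encode (decode a) = a" "encode (decode b) = b"
      "encode (decode ((e - 5) div 4)) = (e - 5) div 4"
      using less by auto
    have eq: "4 * ((e - 5) div 4) + (e - 5) mod 4 = e - 5"
      by (rule mult_div_mod_eq)
    have "(e - 5) mod 4 < 4" by simp
    then have "(e - 5) mod 4 = 0 \<or> (e - 5) mod 4 = 1 \<or> (e - 5) mod 4 = 2 \<or> (e - 5) mod 4 = 3"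
      by linarith
    then show ?thesis
    proof (elim disjE)
      assume r: "(e - 5) mod 4 = 0"
      have "5 + 4 * ((e - 5) div 4) = e" using r False eq by linarith
      moreover have "decode e = PPair (decode a) (decode b)"
        using False r by (subst decode.simps) (simp add: ab)
      ultimately show ?thesis by (simp add: k IH)
    next
      assume r: "(e - 5) mod 4 = 1"
      have "6 + 4 * ((e - 5) div 4) = e" using r False eq by linarith
      moreover have "decode e = PComp (decode a) (decode b)"
        using False r by (subst decode.simps) (simp add: ab)
      ultimately show ?thesis by (simp add: k IH)
    next
      assume r: "(e - 5) mod 4 = 2"
      have "7 + 4 * ((e - 5) div 4) = e" using r False eq by linarith
      moreover have "decode e = PPrec (decode a) (decode b)"
        using False r by (subst decode.simps) (simp add: ab)
      ultimately show ?thesis by (simp add: k IH)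
    next
      assume r: "(e - 5) mod 4 = 3"
      have "8 + 4 * ((e - 5) div 4) = e" using r False eq by linarith
      moreover have "decode e = PMin (decode ((e - 5) div 4))"
        using False r by (subst decode.simps) (simp add: ab)
      ultimately show ?thesis by (simp add: k IH)
    qed
  qed
qed

lemma bij_decode: "bij decode"
  by (rule bij_betw_byWitness[where f' = encode]) (auto simp: decode_encode encode_decode)

lemma W_stage_mono: "s \<le> t \<Longrightarrow> W_stage e s \<subseteq> W_stage e t"
  unfolding W_stage_def by (auto intro: run_mono)

lemma UN_W_stage: "(\<Union>s. W_stage e s) = W e"
proof
  show "(\<Union>s. W_stage e s) \<subseteq> W e"
    by (auto simp: W_stage_def W_def converges_def)
  show "W e \<subseteq> (\<Union>s. W_stage e s)"
  proof
    fix x assume "x \<in> W e"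
    then obtain s y where "run {} s (decode e) x = Some y"
      by (auto simp: W_def converges_def)
    then have "run {} (max s (Suc x)) (decode e) x = Some y"
      by (rule run_mono) simp
    then have "x \<in> W_stage e (max s (Suc x))"
      by (simp add: W_stage_def del: run.simps)
    then show "x \<in> (\<Union>s. W_stage e s)" by blast
  qed
qed

lemma bij_tuple: "bij_betw (tuple (Suc n)) UNIV {xs. length xs = Suc n}"
proof (induction n)
  case 0
  then show ?case
    by (auto simp: bij_betw_def inj_on_def image_def length_Suc_conv)
next
  case (Suc n)
  have inj: "inj (tuple (Suc n))" and surj: "range (tuple (Suc n)) = {xs. length xs = Suc n}"
    using Suc by (auto simp: bij_betw_def)
  have "inj (tuple (Suc (Suc n)))"
    using inj by (auto simp: inj_def) (metis prod_decode_eq prod_eqI)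
  moreover have "range (tuple (Suc (Suc n))) = {xs. length xs = Suc (Suc n)}"
  proof (intro equalityI subsetI)
    fix xs assume "xs \<in> range (tuple (Suc (Suc n)))"
    then show "xs \<in> {xs. length xs = Suc (Suc n)}" using surj by auto
  next
    fix xs :: "nat list" assume "xs \<in> {xs. length xs = Suc (Suc n)}"
    then obtain y ys where xs: "xs = y # ys" and "length ys = Suc n"
      by (auto simp: length_Suc_conv)
    then have "ys \<in> range (tuple (Suc n))" using surj by simp
    then obtain e where "ys = tuple (Suc n) e" by blast
    then have "xs = tuple (Suc (Suc n)) (prod_encode (y, e))" using xs by simp
    then show "xs \<in> range (tuple (Suc (Suc n)))" by blast
  qed
  ultimately show ?case by (simp only: bij_betw_def)
qed

end

theory Submission imports Defs begin

text \<open>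
  The proof is a finite injury construction. Let \<open>A = \<Phi>\<^sub>c(B)\<close> with \<open>B\<close> c.e., and let \<open>p(s)\<close> be the
  first stage after \<open>s\<close> at which the reduction is correct on \<open>[0, s]\<close>. If the 2-c.e. set \<open>X\<^sub>j = -B\<close>
  respects \<open>p\<close>, then no witness \<open>x\<close> may enter \<open>A\<close> while every number below the use of \<open>\<Phi>\<^sub>c(B; x) = 0\<close> is in
  \<open>B\<close> or in \<open>X\<^sub>j\<close>, since the change of \<open>B\<close> that follows would come too early for \<open>p\<close>. As \<open>A\<close> is to be
  3-tardy, \<open>x\<close> must be taken out of 3-c.e. sets and then wait for computations \<open>\<phi>\<^sub>e\<close> before it
  enters \<open>A\<close>; if it does not enter, it is put back for good. During this wait the opponent has to
  make a number below the use leave \<open>X\<^sub>j\<close>, which commits him to put it into \<open>B\<close>. Hence every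
  attempt forces a change of \<open>B\<close> below the use, and a function \<open>p'\<close> that waits for these changes is
  total. An attempt made when \<open>B\<close> and \<open>X\<^sub>k\<close> also cover the use shows that \<open>X\<^sub>k\<close> does not respect \<open>p'\<close>.
  Such attempts are made for all \<open>k\<close>, so \<open>B\<close> is not 2-tardy.

  Each requirement puts at most one number into \<open>A\<close>. The guesses at the set of relevant total
  functions are built into the witnesses.
\<close>

section \<open>Computable functions and decidable predicates\<close>

abbreviation pfst :: "nat \<Rightarrow> nat" where "pfst z \<equiv> fst (prod_decode z)"
abbreviation psnd :: "nat \<Rightarrow> nat" where "psnd z \<equiv> snd (prod_decode z)"

definition decidable :: "(nat \<Rightarrow> bool) \<Rightarrow> bool" where
  "decidable P \<longleftrightarrow> computable (\<lambda>z. of_bool (P z))"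

lemma computable_const: "computable (\<lambda>z. n)"
proof (induction n)
  case 0
  show ?case unfolding computable_in_def by (rule exI[of _ PZero]) (simp add: converges_PZero)
next
  case (Suc n)
  then obtain c where "\<forall>x. converges {} c x n" unfolding computable_in_def by blast
  then have "\<forall>x. converges {} (PComp PSucc c) x (Suc n)"
    by (auto simp: converges_PComp converges_PSucc)
  then show ?case unfolding computable_in_def by blast
qed

lemma computable_id: "computable (\<lambda>z. z)"
proof -
  have "\<forall>x. converges {} (PPair PFst PSnd) x x"
    by (simp add: converges_PPair converges_PFst converges_PSnd)
  then show ?thesis unfolding computable_in_def by blast
qed

lemma computable_comp:
  assumes "computable f" "computable g"
  shows "computable (\<lambda>z. f (g z))"
proof -
  obtain c d where "\<forall>x. converges {} c x (f x)" "\<forall>x. converges {} d x (g x)"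
    using assms unfolding computable_in_def by blast
  then have "\<forall>x. converges {} (PComp c d) x (f (g x))"
    by (auto simp: converges_PComp)
  then show ?thesis unfolding computable_in_def by blast
qed

lemma computable_Suc: "computable f \<Longrightarrow> computable (\<lambda>z. Suc (f z))"
proof (rule computable_comp[of Suc])
  show "computable Suc" unfolding computable_in_def
    by (rule exI[of _ PSucc]) (simp add: converges_PSucc)
qed

lemma computable_pfst: "computable f \<Longrightarrow> computable (\<lambda>z. pfst (f z))"
proof (rule computable_comp[of pfst])
  show "computable pfst" unfolding computable_in_def
    by (rule exI[of _ PFst]) (simp add: converges_PFst)
qed

lemma computable_psnd: "computable f \<Longrightarrow> computable (\<lambda>z. psnd (f z))"
proof (rule computable_comp[of psnd])
  show "computable psnd" unfolding computable_in_def
    by (rule exI[of _ PSnd]) (simp add: converges_PSnd)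
qed

lemma computable_pair:
  assumes "computable f" "computable g"
  shows "computable (\<lambda>z. prod_encode (f z, g z))"
proof -
  obtain c d where "\<forall>x. converges {} c x (f x)" "\<forall>x. converges {} d x (g x)"
    using assms unfolding computable_in_def by blast
  then have "\<forall>x. converges {} (PPair c d) x (prod_encode (f x, g x))"
    by (auto simp: converges_PPair)
  then show ?thesis unfolding computable_in_def by blast
qed

lemma computable_comp2:
  assumes "computable (\<lambda>w. h (pfst w) (psnd w))" "computable f" "computable g"
  shows "computable (\<lambda>z. h (f z) (g z))"
  using computable_comp[OF assms(1) computable_pair[OF assms(2,3)]] by simp

lemma computable_rec:
  assumes "computable b" "computable n"
    and "computable (\<lambda>w. h (pfst w) (pfst (psnd w)) (psnd (psnd w)))"
  shows "computable (\<lambda>z. rec_nat (b z) (h z) (n z))"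
proof -
  obtain c d where c: "\<forall>x. converges {} c x (b x)"
    and d: "\<forall>w. converges {} d w (h (pfst w) (pfst (psnd w)) (psnd (psnd w)))"
    using assms unfolding computable_in_def by blast
  have "converges {} (PPrec c d) (prod_encode (z, m)) (rec_nat (b z) (h z) m)" for z m
  proof (induction m)
    case 0
    then show ?case using c by (simp add: converges_PPrec_0)
  next
    case (Suc m)
    have "converges {} d (prod_encode (z, prod_encode (m, rec_nat (b z) (h z) m)))
      (rec_nat (b z) (h z) (Suc m))"
      using d[rule_format, of "prod_encode (z, prod_encode (m, rec_nat (b z) (h z) m))"] by simp
    with Suc show ?case unfolding converges_PPrec_Suc by blast
  qed
  then have "computable (\<lambda>w. rec_nat (b (pfst w)) (h (pfst w)) (psnd w))"
    unfolding computable_in_def by (metis prod.collapse prod_decode_inverse)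
  from computable_comp2[OF this computable_id assms(2)] show ?thesis .
qed

lemma computable_add:
  assumes "computable f" "computable g"
  shows "computable (\<lambda>z. f z + g z)"
proof -
  have "computable (\<lambda>z. rec_nat (f z) (\<lambda>_ a. Suc a) (g z))"
    by (intro computable_rec assms computable_Suc computable_psnd computable_id)
  moreover have "rec_nat a (\<lambda>_ a. Suc a) b = a + b" for a b :: nat
    by (induction b) auto
  ultimately show ?thesis by simp
qed

lemma computable_mult:
  assumes "computable f" "computable g"
  shows "computable (\<lambda>z. f z * g z)"
proof -
  have "computable (\<lambda>z. rec_nat 0 (\<lambda>_ a. a + f z) (g z))"
    by (intro computable_rec assms computable_add computable_psnd computable_id computable_const
        computable_comp[OF assms(1)] computable_pfst)
  moreover have "rec_nat 0 (\<lambda>_ c. c + a) b = a * b" for a b :: nat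
    by (induction b) auto
  ultimately show ?thesis by simp
qed

lemma computable_power:
  assumes "computable f" "computable g"
  shows "computable (\<lambda>z. f z ^ g z)"
proof -
  have "computable (\<lambda>z. rec_nat 1 (\<lambda>_ a. a * f z) (g z))"
    by (intro computable_rec assms computable_mult computable_psnd computable_id computable_const
        computable_comp[OF assms(1)] computable_pfst)
  moreover have "rec_nat 1 (\<lambda>_ c. c * a) b = a ^ b" for a b :: nat
    by (induction b) auto
  ultimately show ?thesis by simp
qed

lemma computable_diff:
  assumes "computable f" "computable g"
  shows "computable (\<lambda>z. f z - g z)"
proof -
  have pred: "computable (\<lambda>z. rec_nat 0 (\<lambda>k _. k) z)"
    by (intro computable_rec computable_psnd computable_pfst computable_id computable_const)
  have "computable (\<lambda>z. rec_nat (f z) (\<lambda>_ a. rec_nat 0 (\<lambda>k _. k) a) (g z))"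
    by (intro computable_rec computable_comp[OF pred] computable_psnd computable_id assms)
  moreover have "rec_nat a (\<lambda>_ a. rec_nat 0 (\<lambda>k _. k) a) b = a - b" for a b :: nat
  proof (induction b)
    case (Suc b)
    have "rec_nat 0 (\<lambda>k _. k) c = c - 1" for c :: nat by (cases c) auto
    then show ?case using Suc by simp
  qed simp
  ultimately show ?thesis by simp
qed

section \<open>Decidable predicates and bounded quantifiers\<close>

lemma decidable_comp: "decidable P \<Longrightarrow> computable f \<Longrightarrow> decidable (\<lambda>z. P (f z))"
  unfolding decidable_def by (rule computable_comp)

lemma decidable_const: "decidable (\<lambda>z. P)"
  unfolding decidable_def by (rule computable_const)

lemma decidable_not: "decidable P \<Longrightarrow> decidable (\<lambda>z. \<not> P z)"
proof -
  assume "decidable P"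
  then have "computable (\<lambda>z. 1 - of_bool (P z))"
    unfolding decidable_def by (intro computable_diff computable_const)
  moreover have "(\<lambda>z. 1 - of_bool (P z)) = (\<lambda>z. of_bool (\<not> P z) :: nat)" by auto
  ultimately show ?thesis unfolding decidable_def by simp
qed

lemma decidable_conj: "decidable P \<Longrightarrow> decidable Q \<Longrightarrow> decidable (\<lambda>z. P z \<and> Q z)"
  unfolding decidable_def of_bool_conj by (rule computable_mult)

lemma decidable_disj: "decidable P \<Longrightarrow> decidable Q \<Longrightarrow> decidable (\<lambda>z. P z \<or> Q z)"
  using decidable_not[OF decidable_conj[OF decidable_not decidable_not]] by fastforce

lemma decidable_imp: "decidable P \<Longrightarrow> decidable Q \<Longrightarrow> decidable (\<lambda>z. P z \<longrightarrow> Q z)"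
  unfolding imp_conv_disj by (intro decidable_disj decidable_not)

lemma decidable_iff: "decidable P \<Longrightarrow> decidable Q \<Longrightarrow> decidable (\<lambda>z. P z \<longleftrightarrow> Q z)"
  unfolding iff_conv_conj_imp by (intro decidable_conj decidable_imp)

lemma decidable_if:
  "decidable P \<Longrightarrow> decidable Q \<Longrightarrow> decidable R \<Longrightarrow> decidable (\<lambda>z. if P z then Q z else R z)"
  unfolding if_bool_eq_conj by (intro decidable_conj decidable_imp decidable_not)

lemma computable_if:
  assumes "decidable P" "computable f" "computable g"
  shows "computable (\<lambda>z. if P z then f z else g z)"
proof -
  have "computable (\<lambda>z. of_bool (P z) * f z + of_bool (\<not> P z) * g z)"
    using assms decidable_not[OF assms(1)] unfolding decidable_def
    by (intro computable_add computable_mult)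
  moreover have "(\<lambda>z. of_bool (P z) * f z + of_bool (\<not> P z) * g z) =
      (\<lambda>z. if P z then f z else g z)" by auto
  ultimately show ?thesis by simp
qed

lemma decidable_eq_0: "computable f \<Longrightarrow> decidable (\<lambda>z. f z = 0)"
proof -
  assume "computable f"
  then have "computable (\<lambda>z. 1 - f z)" by (intro computable_diff computable_const)
  moreover have "(\<lambda>z. 1 - f z) = (\<lambda>z. of_bool (f z = 0))" by auto
  ultimately show ?thesis unfolding decidable_def by simp
qed

lemma decidable_le: "computable f \<Longrightarrow> computable g \<Longrightarrow> decidable (\<lambda>z. f z \<le> g z)"
  using decidable_eq_0[OF computable_diff] by fastforce

lemma decidable_less: "computable f \<Longrightarrow> computable g \<Longrightarrow> decidable (\<lambda>z. f z < g z)"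
  unfolding not_le[symmetric] by (intro decidable_not decidable_le)

lemma decidable_eq:
  "computable f \<Longrightarrow> computable g \<Longrightarrow> decidable (\<lambda>z. f z = (g z :: nat))"
  unfolding eq_iff by (intro decidable_conj decidable_le)

lemma decidable_all_less:
  assumes "computable n" "decidable (\<lambda>w. P (pfst w) (psnd w))"
  shows "decidable (\<lambda>z. \<forall>y<n z. P z y)"
proof -
  have "computable (\<lambda>z. rec_nat 1 (\<lambda>y a. a * of_bool (P z y)) (n z))"
    by (intro computable_rec assms computable_const computable_mult computable_psnd computable_id
        computable_pfst computable_comp2[OF assms(2)[unfolded decidable_def]])
  moreover have "rec_nat 1 (\<lambda>y a. a * of_bool (P z y)) m = (of_bool (\<forall>y<m. P z y) :: nat)" for z m
    by (induction m) (auto simp: less_Suc_eq)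
  ultimately show ?thesis unfolding decidable_def by simp
qed

lemma decidable_ex_less:
  assumes "computable n" "decidable (\<lambda>w. P (pfst w) (psnd w))"
  shows "decidable (\<lambda>z. \<exists>y<n z. P z y)"
  using decidable_not[OF decidable_all_less[OF assms(1) decidable_not[OF assms(2)]]] by simp

lemma decidable_all_le:
  assumes "computable n" "decidable (\<lambda>w. P (pfst w) (psnd w))"
  shows "decidable (\<lambda>z. \<forall>y\<le>n z. P z y)"
  using decidable_all_less[OF computable_Suc[OF assms(1)] assms(2)] by (simp add: less_Suc_eq_le)

lemma decidable_ex_le:
  assumes "computable n" "decidable (\<lambda>w. P (pfst w) (psnd w))"
  shows "decidable (\<lambda>z. \<exists>y\<le>n z. P z y)"
  using decidable_ex_less[OF computable_Suc[OF assms(1)] assms(2)] by (simp add: less_Suc_eq_le)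

section \<open>Unbounded search, division and canonical indices\<close>

lemma computable_LEAST:
  assumes P: "decidable (\<lambda>w. P (pfst w) (psnd w))" and ex: "\<And>z. \<exists>y. P z y"
  shows "computable (\<lambda>z. LEAST y. P z y)"
proof -
  obtain c where c: "\<forall>w. converges {} c w (of_bool (\<not> P (pfst w) (psnd w)))"
    using decidable_not[OF P] unfolding decidable_def computable_in_def by blast
  obtain d where d: "\<forall>z. converges {} d z (prod_encode (z, 0))"
    using computable_pair[OF computable_id computable_const] unfolding computable_in_def by blast
  have "converges {} (PMin c) (prod_encode (z, 0)) (LEAST y. P z y)" for z
    unfolding converges_PMin
  proof (intro conjI allI impI)
    show "converges {} c (prod_encode (z, LEAST y. P z y)) 0"
      using c[rule_format, of "prod_encode (z, LEAST y. P z y)"] LeastI_ex[OF ex[of z]] by simp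
  next
    fix i assume "0 \<le> i \<and> i < (LEAST y. P z y)"
    then have "\<not> P z i" using not_less_Least by blast
    then show "\<exists>v. converges {} c (prod_encode (z, i)) (Suc v)"
      using c[rule_format, of "prod_encode (z, i)"] by (intro exI[of _ 0]) simp
  qed simp
  then have "\<forall>z. converges {} (PComp (PMin c) d) z (LEAST y. P z y)"
    using d by (auto simp: converges_PComp)
  then show ?thesis unfolding computable_in_def by blast
qed

text \<open>It suffices that the value can be read off any witness of a decidable relation. This
  serves division and \<open>simulate\<close>, where the witness contains a certificate.\<close>

lemma computable_search:
  assumes P: "decidable (\<lambda>w. P (pfst w) (psnd w))" and ex: "\<And>z. \<exists>y. P z y"
    and g: "computable g" and f: "\<And>z y. P z y \<Longrightarrow> f z = g y"
  shows "computable f"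
proof -
  have "f = (\<lambda>z. g (LEAST y. P z y))"
    using f LeastI_ex[OF ex] by blast
  then show ?thesis using computable_comp[OF g computable_LEAST[OF P ex]] by simp
qed

lemma computable_div:
  assumes "computable f" "computable g"
  shows "computable (\<lambda>z. f z div g z)"
proof -
  have "computable (\<lambda>w. pfst w div psnd w)"
  proof (rule computable_search)
    \<comment> \<open>The separate clause matches the convention that division by 0 gives 0; without
      it the search would not halt there.\<close>
    show "decidable (\<lambda>w. (\<lambda>w y. if psnd w = 0 then y = 0 else
        psnd w * y \<le> pfst w \<and> pfst w < psnd w * Suc y) (pfst w) (psnd w))"
      by (intro decidable_if decidable_conj decidable_le decidable_less decidable_eq computable_mult
        computable_Suc computable_psnd computable_pfst computable_id computable_const)
    show "\<exists>y. if psnd w = 0 then y = 0 else psnd w * y \<le> pfst w \<and> pfst w < psnd w * Suc y" for w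
    proof (cases "psnd w = 0")
      case False
      then show ?thesis
        by (intro exI[of _ "pfst w div psnd w"])
          (simp only: if_False, metis dividend_less_times_div times_div_less_eq_dividend
            mult_Suc_right neq0_conv)
    qed simp
    show "computable (\<lambda>y. y)" by (rule computable_id)
    show "pfst w div psnd w = y"
      if "if psnd w = 0 then y = 0 else psnd w * y \<le> pfst w \<and> pfst w < psnd w * Suc y" for w y
    proof (cases "psnd w = 0")
      case False
      with that show ?thesis by (intro div_nat_eqI) (auto simp: mult.commute)
    qed (use that in simp)
  qed
  from computable_comp2[OF this assms] show ?thesis .
qed

lemma computable_mod:
  "computable f \<Longrightarrow> computable g \<Longrightarrow> computable (\<lambda>z. f z mod g z)"
  unfolding minus_mult_div_eq_mod[symmetric]
  by (intro computable_diff computable_mult computable_div)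

lemma decidable_in_set_decode:
  "computable f \<Longrightarrow> computable g \<Longrightarrow> decidable (\<lambda>z. f z \<in> set_decode (g z))"
  unfolding set_decode_def mem_Collect_eq odd_iff_mod_2_eq_one
  by (intro decidable_eq computable_mod computable_div computable_power computable_const)

lemma computable_set_encode:
  assumes "computable n" "decidable (\<lambda>w. P (pfst w) (psnd w))"
  shows "computable (\<lambda>z. set_encode {y. y < n z \<and> P z y})"
proof -
  have "computable (\<lambda>z. rec_nat 0 (\<lambda>y a. a + of_bool (P z y) * 2 ^ y) (n z))"
    by (intro computable_rec assms computable_const computable_add computable_mult computable_psnd
        computable_id computable_pfst computable_power
        computable_comp2[OF assms(2)[unfolded decidable_def]])
  moreover have "rec_nat 0 (\<lambda>y a. a + of_bool (P z y) * 2 ^ y) m = set_encode {y. y < m \<and> P z y}" for z m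
  proof (induction m)
    case (Suc m)
    have "{y. y < Suc m \<and> P z y} =
        (if P z m then insert m {y. y < m \<and> P z y} else {y. y < m \<and> P z y})"
      by (auto simp: less_Suc_eq)
    then show ?case using Suc by simp
  qed (simp add: set_encode_def)
  ultimately show ?thesis by simp
qed

lemmas computability_intros =
  computable_const computable_id computable_Suc computable_pfst computable_psnd computable_pair
  computable_add computable_mult computable_power computable_diff computable_div computable_mod
  computable_if
  decidable_const decidable_not decidable_conj decidable_disj decidable_imp decidable_iff
  decidable_if decidable_eq decidable_le decidable_less decidable_all_less decidable_ex_less
  decidable_all_le decidable_ex_le decidable_in_set_decode

section \<open>Computations with finitely much oracle information\<close>

text \<open>A query outside the domain of \<open>Q\<close> makes the run fail, so a successful run
  depends only on the part of the oracle that \<open>Q\<close> specifies.\<close>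

fun prun :: "(nat \<Rightarrow> nat option) \<Rightarrow> nat \<Rightarrow> prog \<Rightarrow> nat \<Rightarrow> nat option" where
  "prun Q 0 c x = None"
| "prun Q (Suc s) PZero x = Some 0"
| "prun Q (Suc s) PSucc x = Some (Suc x)"
| "prun Q (Suc s) PFst x = Some (pfst x)"
| "prun Q (Suc s) PSnd x = Some (psnd x)"
| "prun Q (Suc s) POracle x = Q x"
| "prun Q (Suc s) (PPair c d) x =
     (case prun Q s c x of None \<Rightarrow> None | Some y \<Rightarrow>
       (case prun Q s d x of None \<Rightarrow> None | Some z \<Rightarrow> Some (prod_encode (y, z))))"
| "prun Q (Suc s) (PComp c d) x =
     (case prun Q s d x of None \<Rightarrow> None | Some y \<Rightarrow> prun Q s c y)"
| "prun Q (Suc s) (PPrec c d) x =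
     (case prod_decode x of (a, m) \<Rightarrow>
       (case m of
          0 \<Rightarrow> prun Q s c a
        | Suc n \<Rightarrow>
            (case prun Q s (PPrec c d) (prod_encode (a, n)) of None \<Rightarrow> None
             | Some y \<Rightarrow> prun Q s d (prod_encode (a, prod_encode (n, y))))))"
| "prun Q (Suc s) (PMin c) x =
     (case prod_decode x of (a, m) \<Rightarrow>
       (case prun Q s c x of
          None \<Rightarrow> None
        | Some 0 \<Rightarrow> Some m
        | Some (Suc _) \<Rightarrow> prun Q s (PMin c) (prod_encode (a, Suc m))))"

lemma run_eq_prun: "run B s c x = prun (\<lambda>x. Some (chi B x)) s c x"
  by (induction B s c x rule: run.induct) (auto split: option.split nat.split prod.split)

lemma prun_mono:
  assumes "prun Q s c x = Some y" "Q \<subseteq>\<^sub>m Q'"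
  shows "prun Q' s c x = Some y"
  using assms
proof (induction Q s c x arbitrary: y rule: prun.induct)
  case (6 Q s x)
  then show ?case by (auto simp: map_le_def dom_def)
next
  case (9 Q s c d x)
  then show ?case by (cases "prod_decode x") (fastforce split: option.splits nat.splits)
next
  case (10 Q s c x)
  then show ?case by (cases "prod_decode x") (fastforce split: option.splits nat.splits)
qed (auto split: option.splits)

definition truncate :: "nat set \<Rightarrow> nat \<Rightarrow> nat \<Rightarrow> nat option" where
  "truncate B u x = (if x < u then Some (chi B x) else None)"

lemma truncate_mono: "u \<le> u' \<Longrightarrow> truncate B u \<subseteq>\<^sub>m truncate B u'"
  by (auto simp: map_le_def truncate_def split: if_splits)

lemma truncate_cong: "\<forall>y<u. y \<in> B \<longleftrightarrow> y \<in> B' \<Longrightarrow> truncate B u = truncate B' u"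
  by (auto simp: fun_eq_iff truncate_def chi_def)

lemma prun_depth_mono:
  assumes "prun (truncate B u) s c x = Some y" "s \<le> t"
  shows "prun (truncate B u) t c x = Some y"
proof -
  have "prun Q s c x = Some y \<Longrightarrow> prun Q (Suc s) c x = Some y" for Q s c x y
  proof (induction Q s c x arbitrary: y rule: prun.induct)
    case (9 Q s c d x)
    then show ?case by (cases "prod_decode x") (fastforce split: option.splits nat.splits)
  next
    case (10 Q s c x)
    obtain a m where x: "prod_decode x = (a, m)" by (cases "prod_decode x")
    obtain v where v: "prun Q s c x = Some v"
      using "10.prems" x by (auto split: option.splits)
    show ?case
      using "10.IH"(1)[OF x[symmetric] v] "10.IH"(2)[OF x[symmetric] v] "10.prems" x v
      by (cases v) (simp_all del: prun.simps add: prun.simps(10))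
  qed (fastforce split: option.splits)+
  with assms show ?thesis
    by (induction t rule: nat_induct) (auto simp: le_Suc_eq simp del: prun.simps)
qed

text \<open>A single number \<open>u\<close> bounds both the queries and the depth. Successful runs
  persist when it grows, so any two can be compared at the larger bound.\<close>

lemma prun_truncate_mono:
  "prun (truncate B u) u c x = Some y \<Longrightarrow> u \<le> u' \<Longrightarrow> prun (truncate B u') u' c x = Some y"
  using prun_depth_mono prun_mono truncate_mono by meson

lemma prun_truncate_unique:
  assumes "prun (truncate B u) u c x = Some y" "prun (truncate B u') u' c x = Some y'"
  shows "y = y'"
  using prun_truncate_mono[OF assms(1), of "max u u'"] prun_truncate_mono[OF assms(2), of "max u u'"]
  by simp

text \<open>The use principle: a halting run makes finitely many queries. Subcomputations have their
  own bounds, and monotonicity in the truncated oracle allows passing to the maximum.\<close>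

lemma run_finite_use:
  assumes "run B s c x = Some y"
  shows "\<exists>u. prun (truncate B u) s c x = Some y"
  using assms
proof (induction B s c x arbitrary: y rule: run.induct)
  case (6 B s x)
  then show ?case by (intro exI[of _ "Suc x"]) (simp add: truncate_def)
next
  case (7 B s c d x)
  then obtain y1 y2 where 1: "run B s c x = Some y1" and 2: "run B s d x = Some y2"
    and y: "y = prod_encode (y1, y2)"
    by (auto split: option.splits)
  obtain u1 u2 where "prun (truncate B u1) s c x = Some y1" "prun (truncate B u2) s d x = Some y2"
    using "7.IH"(1)[OF 1] "7.IH"(2)[OF 1 2] by blast
  then have "prun (truncate B (max u1 u2)) s c x = Some y1" "prun (truncate B (max u1 u2)) s d x = Some y2"
    by (meson prun_mono truncate_mono max.cobounded1 max.cobounded2)+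
  then show ?case using y by (intro exI[of _ "max u1 u2"]) simp
next
  case (8 B s c d x)
  then obtain y1 where 1: "run B s d x = Some y1" and 2: "run B s c y1 = Some y"
    by (auto split: option.splits)
  obtain u1 u2 where "prun (truncate B u1) s d x = Some y1" "prun (truncate B u2) s c y1 = Some y"
    using "8.IH"(1)[OF 1] "8.IH"(2)[OF 1 2] by blast
  then have "prun (truncate B (max u1 u2)) s d x = Some y1" "prun (truncate B (max u1 u2)) s c y1 = Some y"
    by (meson prun_mono truncate_mono max.cobounded1 max.cobounded2)+
  then show ?case by (intro exI[of _ "max u1 u2"]) simp
next
  case (9 B s c d x)
  obtain a m where x: "prod_decode x = (a, m)" by (cases "prod_decode x")
  show ?case
  proof (cases m)
    case 0
    then show ?thesis using 9 x by auto
  next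
    case (Suc n)
    then obtain z where 1: "run B s (PPrec c d) (prod_encode (a, n)) = Some z"
      and 2: "run B s d (prod_encode (a, prod_encode (n, z))) = Some y"
      using "9.prems" x by (auto split: option.splits)
    obtain u1 u2 where "prun (truncate B u1) s (PPrec c d) (prod_encode (a, n)) = Some z"
      "prun (truncate B u2) s d (prod_encode (a, prod_encode (n, z))) = Some y"
      using "9.IH"(2)[OF x[symmetric] Suc 1] "9.IH"(3)[OF x[symmetric] Suc 1 2] by blast
    then have "prun (truncate B (max u1 u2)) s (PPrec c d) (prod_encode (a, n)) = Some z"
      "prun (truncate B (max u1 u2)) s d (prod_encode (a, prod_encode (n, z))) = Some y"
      by (meson prun_mono truncate_mono max.cobounded1 max.cobounded2)+
    then show ?thesis using x Suc by (intro exI[of _ "max u1 u2"]) simp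
  qed
next
  case (10 B s c x)
  obtain a m where x: "prod_decode x = (a, m)" by (cases "prod_decode x")
  obtain v where 1: "run B s c x = Some v"
    using "10.prems" x by (auto split: option.splits)
  obtain u1 where u1: "prun (truncate B u1) s c x = Some v"
    using "10.IH"(1)[OF x[symmetric] 1] by blast
  show ?case
  proof (cases v)
    case 0
    then show ?thesis using "10.prems" x 1 u1 by (intro exI[of _ u1]) simp
  next
    case (Suc w)
    then have 2: "run B s (PMin c) (prod_encode (a, Suc m)) = Some y"
      using "10.prems" x 1 by simp
    then obtain u2 where "prun (truncate B u2) s (PMin c) (prod_encode (a, Suc m)) = Some y"
      using "10.IH"(2)[OF x[symmetric] 1 Suc] by blast
    with u1 have "prun (truncate B (max u1 u2)) s c x = Some v"
      "prun (truncate B (max u1 u2)) s (PMin c) (prod_encode (a, Suc m)) = Some y"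
      by (meson prun_mono truncate_mono max.cobounded1 max.cobounded2)+
    then show ?thesis using x Suc by (intro exI[of _ "max u1 u2"]) simp
  qed
qed auto

lemma converges_prun:
  assumes "converges B c x y"
  shows "\<exists>u. prun (truncate B u) u c x = Some y"
proof -
  obtain s u where "prun (truncate B u) s c x = Some y"
    using assms run_finite_use unfolding converges_def by blast
  then have "prun (truncate B (max u s)) s c x = Some y"
    by (meson prun_mono truncate_mono max.cobounded1)
  then show ?thesis using prun_depth_mono max.cobounded2 by blast
qed

section \<open>Universal simulation\<close>

text \<open>
  \<open>oracle_of D u\<close> is the restriction to \<open>[0, u)\<close> of the set with canonical index \<open>D\<close>, except that
  \<open>u = 0\<close> stands for the full empty oracle.
\<close>

definition oracle_of :: "nat \<Rightarrow> nat \<Rightarrow> nat \<Rightarrow> nat option" where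
  "oracle_of D u x =
     (if x < u then Some (chi (set_decode D) x) else if u = 0 then Some 0 else None)"

definition simulate :: "nat \<Rightarrow> nat \<Rightarrow> nat \<Rightarrow> nat \<Rightarrow> nat" where
  "simulate D u s q =
     (case prun (oracle_of D u) s (decode (pfst q)) (psnd q) of None \<Rightarrow> 0 | Some y \<Rightarrow> Suc y)"

text \<open>
  A query \<open>q\<close> codes a pair of a program index and an input. To unify the cases, every program is
  taken to make two recursive calls, the second of which may depend on the result of the first;
  where a call is not needed, it is a dummy that \<open>outcome\<close> ignores. Results are 0 for divergence and
  \<open>y + 1\<close> for the value \<open>y\<close>.
\<close>

definition call1 :: "nat \<Rightarrow> nat" where
  "call1 q = (let e = pfst q; x = psnd q; k = (e - 5) div 4; r = (e - 5) mod 4 in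
     if r = 0 then prod_encode (pfst k, x)
     else if r = 1 then prod_encode (psnd k, x)
     else if r = 2 then
       (if psnd x = 0 then prod_encode (pfst k, pfst x)
        else prod_encode (e, prod_encode (pfst x, psnd x - 1)))
     else prod_encode (k, x))"

definition call2 :: "nat \<Rightarrow> nat \<Rightarrow> nat" where
  "call2 q v = (let e = pfst q; x = psnd q; k = (e - 5) div 4; r = (e - 5) mod 4 in
     if r = 0 then prod_encode (psnd k, x)
     else if r = 1 then prod_encode (pfst k, v - 1)
     else if r = 2 then prod_encode (psnd k, prod_encode (pfst x, prod_encode (psnd x - 1, v - 1)))
     else prod_encode (e, prod_encode (pfst x, Suc (psnd x))))"

definition outcome :: "nat \<Rightarrow> nat \<Rightarrow> nat \<Rightarrow> nat \<Rightarrow> nat \<Rightarrow> nat" where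
  "outcome D u q v v' = (let e = pfst q; x = psnd q; r = (e - 5) mod 4 in
     if e = 0 then 1
     else if e = 1 then Suc (Suc x)
     else if e = 2 then Suc (pfst x)
     else if e = 3 then Suc (psnd x)
     else if e = 4 then
       (if x < u then (if x \<in> set_decode D then 2 else 1) else if u = 0 then 1 else 0)
     else if r = 0 then (if v = 0 \<or> v' = 0 then 0 else Suc (prod_encode (v - 1, v' - 1)))
     else if r = 1 then (if v = 0 then 0 else v')
     else if r = 2 then (if psnd x = 0 then v else if v = 0 then 0 else v')
     else (if v = 0 then 0 else if v = 1 then Suc (psnd x) else v'))"

lemma simulate_0: "simulate D u 0 q = 0"
  by (simp add: simulate_def)

text \<open>All program constructors now share one recursion on the depth in which only the query
  changes, so a single kind of certificate entry is enough.\<close>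

lemma simulate_Suc:
  "simulate D u (Suc s) q =
     outcome D u q (simulate D u s (call1 q)) (simulate D u s (call2 q (simulate D u s (call1 q))))"
proof -
  obtain e x where q: "q = prod_encode (e, x)" by (metis prod.collapse prod_decode_inverse)
  obtain c where e: "e = encode c" by (metis encode_decode)
  have [simp]: "(4 * k) div 4 = k" "(4 * k) mod 4 = 0" "(Suc (4 * k)) div 4 = k"
    "(Suc (4 * k)) mod 4 = 1" "(Suc (Suc (4 * k))) div 4 = k"
    "(Suc (Suc (4 * k))) mod 4 = 2" "(3 + 4 * k) div 4 = k" "(3 + 4 * k) mod 4 = 3" for k :: nat
    by presburger+
  obtain a m where x: "x = prod_encode (a, m)" by (metis prod.collapse prod_decode_inverse)
  have dec: "decode (6 + 4 * prod_encode (encode c, encode d)) = PComp c d"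
    "decode (5 + 4 * prod_encode (encode c, encode d)) = PPair c d"
    "decode (7 + 4 * prod_encode (encode c, encode d)) = PPrec c d"
    "decode (8 + 4 * encode c) = PMin c" for c d
    using decode_encode[of "PComp c d"] decode_encode[of "PPair c d"]
      decode_encode[of "PPrec c d"] decode_encode[of "PMin c"] by simp_all
  show ?thesis
  proof (cases c)
    case PZero
    then show ?thesis using decode_encode[of PZero] by (simp add: q e simulate_def outcome_def)
  next
    case PSucc
    then show ?thesis using decode_encode[of PSucc] by (simp add: q e simulate_def outcome_def)
  next
    case PFst
    then show ?thesis using decode_encode[of PFst] by (simp add: q e simulate_def outcome_def)
  next
    case PSnd
    then show ?thesis using decode_encode[of PSnd] by (simp add: q e simulate_def outcome_def)
  next
    case POracle
    then show ?thesis using decode_encode[of POracle]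
      by (simp add: q e simulate_def outcome_def oracle_of_def chi_def)
  next
    case (PPair c d)
    then show ?thesis
      by (auto simp: q e simulate_def outcome_def call1_def call2_def Let_def decode_encode dec
          split: option.split)
  next
    case (PComp c d)
    then show ?thesis
      by (auto simp: q e simulate_def outcome_def call1_def call2_def Let_def decode_encode dec
          split: option.split)
  next
    case (PPrec c d)
    then show ?thesis
      by (auto simp: q e x simulate_def outcome_def call1_def call2_def Let_def decode_encode dec
          split: option.split nat.split)
  next
    case (PMin c)
    then show ?thesis
      by (auto simp: q e x simulate_def outcome_def call1_def call2_def Let_def decode_encode dec
          split: option.split nat.split)
  qed
qed

definition entry :: "nat \<Rightarrow> nat \<Rightarrow> nat \<Rightarrow> nat" where
  "entry s q v = prod_encode (prod_encode (s, q), v)"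

text \<open>
  The recursion on the depth is not primitive, as it changes the other arguments. Instead one
  searches for a certificate, a finite set of entries each of which follows from others.
\<close>

definition justified :: "nat \<Rightarrow> nat \<Rightarrow> nat set \<Rightarrow> nat \<Rightarrow> bool" where
  "justified D u T t = (let s = pfst (pfst t); q = psnd (pfst t); v = psnd t in
     if s = 0 then v = 0
     else \<exists>v1 v2. entry (s - 1) (call1 q) v1 \<in> T \<and> entry (s - 1) (call2 q v1) v2 \<in> T \<and>
       v = outcome D u q v1 v2)"

lemma justified_entry:
  "justified D u T (entry 0 q v) \<longleftrightarrow> v = 0"
  "justified D u T (entry (Suc s) q v) \<longleftrightarrow>
     (\<exists>v1 v2. entry s (call1 q) v1 \<in> T \<and> entry s (call2 q v1) v2 \<in> T \<and> v = outcome D u q v1 v2)"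
  by (simp_all add: justified_def entry_def)

lemma justified_mono: "justified D u T t \<Longrightarrow> T \<subseteq> T' \<Longrightarrow> justified D u T' t"
  unfolding justified_def Let_def by (auto split: if_splits)

text \<open>Nothing forces a certificate to hold just one value per query, but induction on the
  depth shows the supporting entries, and hence each entry, to be correct.\<close>

lemma certificate_sound:
  assumes "\<forall>t\<in>T. justified D u T t" "entry s q v \<in> T"
  shows "v = simulate D u s q"
  using assms(2)
proof (induction s arbitrary: q v)
  case 0
  then have "justified D u T (entry 0 q v)" using assms(1) by blast
  then show ?case by (simp add: justified_entry simulate_0)
next
  case (Suc s)
  then have "justified D u T (entry (Suc s) q v)" using assms(1) by blast
  then show ?case using Suc.IH unfolding justified_entry simulate_Suc by metis
qed

text \<open>Certificates for the two calls can be united, since justification survives in larger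
  sets; the new entry is then added.\<close>

lemma certificate_exists:
  "\<exists>T. finite T \<and> (\<forall>t\<in>T. justified D u T t) \<and> entry s q (simulate D u s q) \<in> T"
proof (induction s arbitrary: q)
  case 0
  show ?case
    by (intro exI[of _ "{entry 0 q 0}"]) (simp add: justified_entry simulate_0)
next
  case (Suc s)
  let ?v1 = "simulate D u s (call1 q)"
  let ?v2 = "simulate D u s (call2 q ?v1)"
  obtain T1 T2 where T1: "finite T1" "\<forall>t\<in>T1. justified D u T1 t" "entry s (call1 q) ?v1 \<in> T1"
    and T2: "finite T2" "\<forall>t\<in>T2. justified D u T2 t" "entry s (call2 q ?v1) ?v2 \<in> T2"
    using Suc.IH by metis
  let ?T = "insert (entry (Suc s) q (simulate D u (Suc s) q)) (T1 \<union> T2)"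
  have "justified D u ?T (entry (Suc s) q (simulate D u (Suc s) q))"
    unfolding justified_entry using T1(3) T2(3) simulate_Suc by blast
  moreover have "\<forall>t\<in>T1 \<union> T2. justified D u ?T t"
    using T1(2) T2(2) by (blast intro: justified_mono)
  ultimately show ?case
    using T1(1) T2(1) by (intro exI[of _ ?T]) simp
qed

text \<open>This bounds quantifiers over a certificate by its code, which makes justification
  decidable.\<close>

lemma less_of_in_set_decode:
  assumes "t \<in> set_decode C"
  shows "t < C"
proof -
  have "C div 2 ^ t \<noteq> 0" using assms by (metis even_zero mem_Collect_eq set_decode_def)
  then have "2 ^ t \<le> C" by (metis div_less not_le)
  then show ?thesis using less_exp[of t] by linarith
qed

lemma entry_result_less: "entry s q v \<in> set_decode C \<Longrightarrow> v < C"
  unfolding entry_def using less_of_in_set_decode le_prod_encode_2 order.strict_trans1 by blast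

section \<open>Computability of the simulation\<close>

lemma computable_call1:
  assumes "computable q"
  shows "computable (\<lambda>z. call1 (q z))"
  unfolding call1_def Let_def by (intro computability_intros assms)

lemma computable_call2:
  assumes "computable q" "computable v"
  shows "computable (\<lambda>z. call2 (q z) (v z))"
  unfolding call2_def Let_def by (intro computability_intros assms)

lemma computable_outcome:
  assumes "computable D" "computable u" "computable q" "computable v" "computable v'"
  shows "computable (\<lambda>z. outcome (D z) (u z) (q z) (v z) (v' z))"
  unfolding outcome_def Let_def by (intro computability_intros assms)

lemma decidable_justified:
  assumes "computable D" "computable u" "computable C" "computable t"
  shows "decidable (\<lambda>z. justified (D z) (u z) (set_decode (C z)) (t z))"
proof -
  have eq: "justified D u (set_decode C) t = (let s = pfst (pfst t); q = psnd (pfst t); v = psnd t in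
     if s = 0 then v = 0
     else \<exists>v1<C. \<exists>v2<C. entry (s - 1) (call1 q) v1 \<in> set_decode C \<and>
       entry (s - 1) (call2 q v1) v2 \<in> set_decode C \<and> v = outcome D u q v1 v2)" for D u C t
    unfolding justified_def Let_def by (meson entry_result_less)
  have "decidable (\<lambda>w. justified (pfst (pfst w)) (psnd (pfst w)) (set_decode (pfst (psnd w))) (psnd (psnd w)))"
    unfolding eq Let_def entry_def
    by (intro computability_intros computable_call1 computable_call2 computable_outcome)
  from decidable_comp[OF this computable_pair[OF computable_pair[OF assms(1,2)] computable_pair[OF assms(3,4)]]]
  show ?thesis by simp
qed

lemma computable_simulate:
  assumes "computable D" "computable u" "computable s" "computable q"
  shows "computable (\<lambda>z. simulate (D z) (u z) (s z) (q z))"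
proof -
  let ?sim = "\<lambda>z. simulate (pfst (pfst z)) (psnd (pfst z)) (pfst (psnd z)) (psnd (psnd z))"
  \<comment> \<open>A witness \<open>y\<close> pairs the code of a certificate with the value
    claimed for the query.\<close>
  let ?P = "\<lambda>z y. (\<forall>t<pfst y. t \<in> set_decode (pfst y) \<longrightarrow>
      justified (pfst (pfst z)) (psnd (pfst z)) (set_decode (pfst y)) t) \<and>
    entry (pfst (psnd z)) (psnd (psnd z)) (psnd y) \<in> set_decode (pfst y)"
  have "computable ?sim"
  proof (rule computable_search[of ?P psnd])
    show "decidable (\<lambda>w. ?P (pfst w) (psnd w))"
      unfolding entry_def by (intro computability_intros decidable_justified)
    show "\<exists>y. ?P z y" for z
    proof -
      obtain T where "finite T" "\<forall>t\<in>T. justified (pfst (pfst z)) (psnd (pfst z)) T t"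
        "entry (pfst (psnd z)) (psnd (psnd z)) (?sim z) \<in> T"
        using certificate_exists[of "pfst (pfst z)" "psnd (pfst z)" "pfst (psnd z)" "psnd (psnd z)"]
        by blast
      then show ?thesis
        by (intro exI[of _ "prod_encode (set_encode T, ?sim z)"]) simp
    qed
    show "computable psnd" by (intro computability_intros)
    show "?sim z = psnd y" if "?P z y" for z y
    proof (rule certificate_sound[symmetric])
      show "\<forall>t\<in>set_decode (pfst y). justified (pfst (pfst z)) (psnd (pfst z)) (set_decode (pfst y)) t"
        using that less_of_in_set_decode by blast
      show "entry (pfst (psnd z)) (psnd (psnd z)) (psnd y) \<in> set_decode (pfst y)"
        using that by blast
    qed
  qed
  from computable_comp[OF this computable_pair[OF computable_pair[OF assms(1,2)] computable_pair[OF assms(3,4)]]]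
  show ?thesis by simp
qed

lemma oracle_of_0: "oracle_of 0 0 = (\<lambda>x. Some (chi {} x))"
  by (simp add: oracle_of_def chi_def fun_eq_iff)

lemma decidable_run_eq:
  assumes "computable s" "computable e" "computable x" "computable v"
  shows "decidable (\<lambda>z. run {} (s z) (decode (e z)) (x z) = Some (v z))"
proof -
  have eq: "run {} s (decode e) x = Some v \<longleftrightarrow> simulate 0 0 s (prod_encode (e, x)) = Suc v" for s e x v
    by (auto simp: simulate_def run_eq_prun oracle_of_0 split: option.split)
  show ?thesis
    unfolding eq by (intro computability_intros computable_simulate assms)
qed

lemma decidable_run_None:
  assumes "computable s" "computable e" "computable x"
  shows "decidable (\<lambda>z. run {} (s z) (decode (e z)) (x z) = None)"
proof -
  have eq: "run {} s (decode e) x = None \<longleftrightarrow> simulate 0 0 s (prod_encode (e, x)) = 0" for s e x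
    by (auto simp: simulate_def run_eq_prun oracle_of_0 split: option.split)
  show ?thesis
    unfolding eq by (intro computability_intros computable_simulate assms)
qed

lemma decidable_W_stage:
  assumes "computable x" "computable e" "computable s"
  shows "decidable (\<lambda>z. x z \<in> W_stage (e z) (s z))"
  unfolding W_stage_def mem_Collect_eq
  by (intro computability_intros decidable_run_None assms)

lemma nce_2: "nce 2 e = W (pfst e) - W (psnd e)"
  and nce_stage_2: "nce_stage 2 e s = W_stage (pfst e) s - W_stage (psnd e) s"
  by (simp_all add: nce_def nce_stage_def numeral_2_eq_2)

lemma decidable_nce_stage_2:
  assumes "computable x" "computable e" "computable s"
  shows "decidable (\<lambda>z. x z \<in> nce_stage 2 (e z) (s z))"
  unfolding nce_stage_2 Diff_iff
  by (intro computability_intros decidable_W_stage assms)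

lemma decidable_prun:
  assumes "computable w" "computable s" "computable u" "computable c" "computable x" "computable v"
  shows "decidable (\<lambda>z. prun (truncate (W_stage (w z) (s z)) (u z)) (u z) (decode (c z)) (x z) = Some (v z))"
proof -
  let ?D = "\<lambda>w s u. set_encode {y. y < u \<and> y \<in> W_stage w s}"
  have tr: "u \<noteq> 0 \<Longrightarrow> oracle_of (?D w s u) u = truncate (W_stage w s) u" for w s u
    by (simp add: oracle_of_def truncate_def chi_def fun_eq_iff)
  \<comment> \<open>For \<open>u = 0\<close> the conventions differ, as \<open>oracle_of\<close>
    then answers every query; both runs still fail, since the depth is 0 as well.\<close>
  have eq: "prun (truncate (W_stage w s) u) u (decode c) x = Some v \<longleftrightarrow>
      simulate (?D w s u) u u (prod_encode (c, x)) = Suc v" for w s u c x v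
    by (cases "u = 0") (auto simp: simulate_def tr split: option.split)
  show ?thesis
    unfolding eq by (intro computability_intros computable_simulate computable_set_encode decidable_W_stage
        assms computable_comp[OF assms(1)] computable_comp[OF assms(2)])
qed

section \<open>Indices and enumerations\<close>

text \<open>Searching for \<open>y\<close> by \<open>PMin\<close> halts on exactly these
  \<open>x\<close>.\<close>

lemma ce_index:
  assumes "decidable (\<lambda>w. M (pfst w) (psnd w))"
  shows "\<exists>i. W i = {x. \<exists>y. M x y}"
proof -
  obtain c where c: "\<forall>w. converges {} c w (of_bool (\<not> M (pfst w) (psnd w)))"
    using decidable_not[OF assms] unfolding decidable_def computable_in_def by blast
  obtain d where d: "\<forall>z. converges {} d z (prod_encode (z, 0))"
    using computable_pair[OF computable_id computable_const] unfolding computable_in_def by blast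
  have "(\<exists>k. converges {} (PComp (PMin c) d) x k) \<longleftrightarrow> (\<exists>y. M x y)" for x
  proof -
    have dx: "converges {} d x y \<longleftrightarrow> y = prod_encode (x, 0)" for y
      using d converges_unique by blast
    have cx: "converges {} c (prod_encode (x, i)) v \<longleftrightarrow> v = of_bool (\<not> M x i)" for i v
      using c[rule_format, of "prod_encode (x, i)"] converges_unique by fastforce
    have "(\<exists>k. converges {} (PComp (PMin c) d) x k) \<longleftrightarrow> (\<exists>k. M x k \<and> (\<forall>i<k. \<not> M x i))"
      unfolding converges_PComp dx by (auto simp: converges_PMin cx)
    also have "\<dots> \<longleftrightarrow> (\<exists>k. M x k)" using exists_least_iff[of "M x"] by blast
    finally show ?thesis .
  qed
  then have "W (encode (PComp (PMin c) d)) = {x. \<exists>y. M x y}"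
    unfolding W_def decode_encode by simp
  then show ?thesis by blast
qed

primrec const_prog :: "nat \<Rightarrow> prog" where
  "const_prog 0 = PZero"
| "const_prog (Suc n) = PComp PSucc (const_prog n)"

lemma run_const_prog: "run B (Suc n) (const_prog n) x = Some n"
  by (induction n) auto

text \<open>
  An s-m-n theorem with a bound on the delay. It makes an appeal to the recursion theorem
  unnecessary: the delay of a uniformly c.e. family is known before its parameter is chosen.
\<close>

lemma W_section:
  obtains f where "\<And>a. W (f a) = {x. prod_encode (a, x) \<in> W e}"
    and "\<And>a x s. prod_encode (a, x) \<in> W_stage e s \<Longrightarrow> x \<in> W_stage (f a) (s + a + 5)"
proof
  \<comment> \<open>\<open>PPair PFst PSnd\<close> is the identity. It needs depth 2 and
    \<open>const_prog a\<close> depth \<open>a + 1\<close>; the pairing and the final composition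
    add one each, so a delay of \<open>a + 5\<close> leaves enough room.\<close>
  let ?pair = "\<lambda>a. PPair (const_prog a) (PPair PFst PSnd)"
  let ?f = "\<lambda>a. encode (PComp (decode e) (?pair a))"
  have pair: "run {} (s + a + 4) (?pair a) x = Some (prod_encode (a, x))" for s a x
  proof -
    have "run {} (s + a + 3) (const_prog a) x = Some a"
      using run_const_prog by (rule run_mono) simp
    moreover have "run {} (s + a + 3) (PPair PFst PSnd) x = Some x"
      by (simp add: eval_nat_numeral)
    ultimately show ?thesis by (simp add: eval_nat_numeral del: run.simps add: run.simps(7))
  qed
  show "W (?f a) = {x. prod_encode (a, x) \<in> W e}" for a
  proof -
    have "converges {} (?pair a) x (prod_encode (a, x))" for x
      using pair unfolding converges_def by blast
    then have "converges {} (?pair a) x y \<longleftrightarrow> y = prod_encode (a, x)" for x y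
      using converges_unique by blast
    then show ?thesis unfolding W_def decode_encode converges_PComp by simp
  qed
  show "x \<in> W_stage (?f a) (s + a + 5)" if "prod_encode (a, x) \<in> W_stage e s" for a x s
  proof -
    from that obtain y where y: "run {} s (decode e) (prod_encode (a, x)) = Some y"
      and "prod_encode (a, x) < s"
      by (auto simp: W_stage_def)
    then have "x < s + a + 5" using le_prod_encode_2[of x a] by linarith
    have "run {} (s + a + 4) (decode e) (prod_encode (a, x)) = Some y"
      using y by (rule run_mono) simp
    then have "run {} (Suc (s + a + 4)) (decode (?f a)) x = Some y"
      by (simp only: decode_encode run.simps(8) pair option.case)
    moreover have "Suc (s + a + 4) = s + a + 5" by simp
    ultimately show ?thesis using \<open>x < s + a + 5\<close> unfolding W_stage_def by (metis (mono_tags) mem_Collect_eq option.distinct(1))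
  qed
qed

lemma W_iff_stage: "y \<in> W e \<longleftrightarrow> (\<exists>s. y \<in> W_stage e s)"
  using UN_W_stage by blast

text \<open>A condition that grows stronger with \<open>s\<close> has a later first solution; this
  gives the monotonicity that tardiness asks of waiting functions.\<close>

lemma mono_Least:
  assumes "\<And>s t t'. s \<le> t \<Longrightarrow> P t t' \<Longrightarrow> P s (t' :: nat)" and "\<And>s. \<exists>t. P s t"
  shows "mono (\<lambda>s :: nat. LEAST t. P s t)"
  by (intro monoI Least_le) (meson assms LeastI_ex)

text \<open>Passage to the standard enumeration: the given one, \<open>Bs\<close>, is consulted at
  the first stage by which it contains \<open>W_stage w (p s)\<close>.\<close>

lemma tardy_W_stage:
  assumes "tardy n (W w)" "computable p" "mono p"
  shows "\<exists>e. nce n e = - W w \<and> (\<forall>x s. x \<in> nce_stage n e s \<longrightarrow> x \<notin> W_stage w (p s))"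
proof -
  obtain Bs where B: "computable_enumeration Bs (W w)"
    and tardy: "\<And>p. computable p \<Longrightarrow> mono p \<Longrightarrow>
      \<exists>e. nce n e = - W w \<and> (\<forall>x s. x \<in> nce_stage n e s \<longrightarrow> x \<notin> Bs (p s))"
    using assms(1) unfolding tardy_def by blast
  have fin: "finite (Bs t)" for t using B unfolding computable_enumeration_def by blast
  have "mono Bs" using B unfolding computable_enumeration_def by (simp add: mono_iff_le_Suc)
  have UN: "(\<Union>t. Bs t) = W w" and code: "computable (\<lambda>t. set_encode (Bs t))"
    using B unfolding computable_enumeration_def by blast+
  let ?P = "\<lambda>s t. \<forall>y<p s. y \<in> W_stage w (p s) \<longrightarrow> y \<in> set_decode (set_encode (Bs t))"
  have P: "?P s t \<longleftrightarrow> W_stage w (p s) \<subseteq> Bs t" for s t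
    using fin by (auto simp: W_stage_def)
  have ex: "\<exists>t. ?P s t" for s
  proof -
    have "finite (W_stage w (p s))" by (simp add: W_stage_def)
    moreover have "W_stage w (p s) \<subseteq> (\<Union>t. Bs t)" unfolding UN using W_iff_stage by auto
    moreover have "\<forall>\<^sub>F t in sequentially. y \<in> Bs t" if y: "y \<in> (\<Union>t. Bs t)" for y
      using y monoD[OF \<open>mono Bs\<close>] unfolding eventually_sequentially by blast
    ultimately have "\<forall>\<^sub>F t in sequentially. \<forall>y\<in>W_stage w (p s). y \<in> Bs t"
      by (intro eventually_ball_finite) blast+
    then obtain t where "W_stage w (p s) \<subseteq> Bs t"
      unfolding eventually_sequentially by blast
    then show ?thesis unfolding P by blast
  qed
  have "computable (\<lambda>s. LEAST t. ?P s t)"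
    by (rule computable_LEAST[of ?P, OF _ ex])
      (intro computability_intros decidable_W_stage assms(2)[THEN computable_comp] code[THEN computable_comp])
  moreover have "mono (\<lambda>s. LEAST t. ?P s t)"
    unfolding P using ex W_stage_mono monoD[OF assms(3)] unfolding P
    by (intro mono_Least) (meson order_trans)+
  ultimately obtain e where e: "nce n e = - W w"
    "\<forall>x s. x \<in> nce_stage n e s \<longrightarrow> x \<notin> Bs (LEAST t. ?P s t)"
    using tardy by blast
  have "W_stage w (p s) \<subseteq> Bs (LEAST t. ?P s t)" for s
    using LeastI_ex[OF ex] unfolding P .
  with e show ?thesis by blast
qed

section \<open>The construction\<close>

definition is_total :: "nat \<Rightarrow> bool" where
  "is_total e \<longleftrightarrow> (\<forall>x. \<exists>y. converges {} (decode e) x y)"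

text \<open>A test of totality: a total \<open>e\<close> passes it eventually for each
  \<open>x\<close>, whereas a non-total one passes it for finitely many \<open>x\<close>
  only.\<close>

definition conv_upto :: "nat \<Rightarrow> nat \<Rightarrow> nat \<Rightarrow> bool" where
  "conv_upto e x s \<longleftrightarrow> (\<forall>z\<le>x. run {} s (decode e) z \<noteq> None)"

text \<open>Stage \<open>s\<close> is past the delay prescribed by
  \<open>\<phi>\<^sub>e(r)\<close>.\<close>

definition value_below :: "nat \<Rightarrow> nat \<Rightarrow> nat \<Rightarrow> bool" where
  "value_below e r s \<longleftrightarrow> (\<exists>v<s. run {} s (decode e) r = Some v)"

definition covers :: "nat \<Rightarrow> nat \<Rightarrow> nat \<Rightarrow> nat \<Rightarrow> bool" where
  "covers w j u s \<longleftrightarrow> (\<forall>y<u. y \<in> W_stage w s \<or> y \<in> nce_stage 2 j s)"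

definition computes :: "nat \<Rightarrow> nat \<Rightarrow> nat \<Rightarrow> nat \<Rightarrow> nat \<Rightarrow> nat \<Rightarrow> bool" where
  "computes w c x v u s \<longleftrightarrow> prun (truncate (W_stage w s) u) u (decode c) x = Some v"

text \<open>
  A number \<open>x\<close> codes a witness \<open>(((w, c, j), G), k, l)\<close>: it is reserved for diagonalizing against
  \<open>A = \<Phi>\<^sub>c(W w)\<close> and the \<open>j\<close>-th 2-c.e. set, under the guess that \<open>G\<close> is the set of the indices
  below \<open>(w, c, j)\<close> of total functions. Its preparation also serves the \<open>k\<close>-th 2-c.e. set, and \<open>l\<close>
  makes \<open>x\<close> large.
\<close>

abbreviation (input) owner :: "nat \<Rightarrow> nat" where "owner x \<equiv> pfst x"
abbreviation (input) req :: "nat \<Rightarrow> nat" where "req x \<equiv> pfst (owner x)"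
abbreviation (input) guess :: "nat \<Rightarrow> nat set" where "guess x \<equiv> set_decode (psnd (owner x))"
abbreviation (input) ce_of :: "nat \<Rightarrow> nat" where "ce_of x \<equiv> pfst (req x)"
abbreviation (input) functional_of :: "nat \<Rightarrow> nat" where "functional_of x \<equiv> pfst (psnd (req x))"
abbreviation (input) main_of :: "nat \<Rightarrow> nat" where "main_of x \<equiv> psnd (psnd (req x))"
abbreviation (input) side_of :: "nat \<Rightarrow> nat" where "side_of x \<equiv> pfst (psnd x)"

text \<open>The code of the guess bounds its members, which keeps the quantifier bounded. Both the
  main and the side 2-c.e. set have to cover the use here; \<open>ready\<close> asks again only for
  the main one.\<close>

definition starts :: "nat \<Rightarrow> nat \<Rightarrow> nat \<Rightarrow> bool" where
  "starts x s u \<longleftrightarrow> x \<le> s \<and> u \<le> s \<and> (\<forall>e<psnd (owner x). e \<in> guess x \<longrightarrow> e < req x \<and> conv_upto e x s) \<and>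
     computes (ce_of x) (functional_of x) x 0 u s \<and>
     covers (ce_of x) (main_of x) u s \<and> covers (ce_of x) (side_of x) u s"

text \<open>\<open>q\<close> is a position as in \<open>pos\<close> below, a counter
  \<open>m\<close> paired with a stage \<open>r\<close>. Before the start the witness waits for
  \<open>starts\<close>; with \<open>m = e + 1\<close> afterwards it waits for
  \<open>\<phi>\<^sub>e(r)\<close>, if \<open>e\<close> is guessed to be total.\<close>

definition advances :: "nat \<Rightarrow> nat \<Rightarrow> nat \<Rightarrow> bool" where
  "advances x s q \<longleftrightarrow> pfst q \<noteq> 0 \<and>
     (if pfst q = Suc (req x) then \<exists>u\<le>s. starts x s u
      else pfst q - 1 \<in> guess x \<longrightarrow> value_below (pfst q - 1) (psnd q) s)"

text \<open>
  \<open>pos x s\<close> codes a pair \<open>(m, r)\<close>: at stage \<open>s\<close> the witness \<open>x\<close> still has to be delayed by the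
  functions with guessed indices below \<open>m\<close>, and it got to this point at stage \<open>r\<close>; \<open>m = req x + 1\<close>
  means that it has not started yet. The delays are served from the largest index to the smallest,
  so that \<open>x\<close> never waits for a function of lower priority than one whose 3-c.e. set it has left.
\<close>

primrec pos :: "nat \<Rightarrow> nat \<Rightarrow> nat" where
  "pos x 0 = prod_encode (Suc (req x), 0)"
| "pos x (Suc s) = (if advances x s (pos x s) then prod_encode (pfst (pos x s) - 1, s) else pos x s)"

text \<open>Stage \<open>s\<close> is the one at which the last delay ends. Only now is the guess
  tested for omissions: an index below \<open>req x\<close> that has converged up to
  \<open>x\<close> must belong to it. The use may differ from the one at the start.\<close>

definition ready :: "nat \<Rightarrow> nat \<Rightarrow> bool" where
  "ready x s \<longleftrightarrow> pfst (pos x s) \<noteq> 0 \<and> pfst (pos x (Suc s)) = 0 \<and>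
     (\<forall>e<req x. e \<notin> guess x \<longrightarrow> \<not> conv_upto e x s) \<and>
     (\<exists>u\<le>s. computes (ce_of x) (functional_of x) x 0 u s \<and> covers (ce_of x) (main_of x) u s)"

text \<open>Of the witnesses with one owner only the first to be ready enters, ties going to the
  smallest. The bound \<open>x' \<le> s\<close> makes this decidable and loses no rival, by
  \<open>ready_le\<close>.\<close>

definition enters :: "nat \<Rightarrow> nat \<Rightarrow> bool" where
  "enters x s \<longleftrightarrow> ready x s \<and>
     \<not> (\<exists>x'\<le>s. \<exists>s'\<le>s. owner x' = owner x \<and> ready x' s' \<and> (s' < s \<or> x' < x))"

definition A_stage :: "nat \<Rightarrow> nat set" where
  "A_stage t = {x. \<exists>s\<le>t. enters x s}"

definition A_set :: "nat set" where
  "A_set = (\<Union>t. A_stage t)"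

section \<open>Decidability of the construction\<close>

lemma decidable_conv_upto:
  assumes "computable e" "computable x" "computable s"
  shows "decidable (\<lambda>z. conv_upto (e z) (x z) (s z))"
  unfolding conv_upto_def
  by (intro computability_intros decidable_run_None assms[THEN computable_comp])

lemma decidable_value_below:
  assumes "computable e" "computable r" "computable s"
  shows "decidable (\<lambda>z. value_below (e z) (r z) (s z))"
  unfolding value_below_def
  by (intro computability_intros decidable_run_eq assms[THEN computable_comp])

lemma decidable_covers:
  assumes "computable w" "computable j" "computable u" "computable s"
  shows "decidable (\<lambda>z. covers (w z) (j z) (u z) (s z))"
  unfolding covers_def
  by (intro computability_intros decidable_W_stage decidable_nce_stage_2 assms[THEN computable_comp])

lemma decidable_computes:
  assumes "computable w" "computable c" "computable x" "computable v" "computable u" "computable s"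
  shows "decidable (\<lambda>z. computes (w z) (c z) (x z) (v z) (u z) (s z))"
  unfolding computes_def by (intro decidable_prun assms)

lemma decidable_starts:
  assumes "computable x" "computable s" "computable u"
  shows "decidable (\<lambda>z. starts (x z) (s z) (u z))"
  unfolding starts_def
  by (intro computability_intros decidable_conv_upto decidable_covers decidable_computes
      assms[THEN computable_comp])

lemma decidable_advances:
  assumes "computable x" "computable s" "computable q"
  shows "decidable (\<lambda>z. advances (x z) (s z) (q z))"
  unfolding advances_def
  by (intro computability_intros decidable_starts decidable_value_below assms[THEN computable_comp])

lemma computable_pos:
  assumes "computable x" "computable s"
  shows "computable (\<lambda>z. pos (x z) (s z))"
proof -
  have pos_eq: "pos x s = rec_nat (prod_encode (Suc (req x), 0))
      (\<lambda>s q. if advances x s q then prod_encode (pfst q - 1, s) else q) s" for x s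
    by (induction s) simp_all
  show ?thesis unfolding pos_eq
    by (intro computable_rec computability_intros decidable_advances assms[THEN computable_comp])
qed

lemma decidable_ready:
  assumes "computable x" "computable s"
  shows "decidable (\<lambda>z. ready (x z) (s z))"
  unfolding ready_def
  by (intro computability_intros computable_pos decidable_conv_upto decidable_covers
      decidable_computes assms[THEN computable_comp])

lemma decidable_enters:
  assumes "computable x" "computable s"
  shows "decidable (\<lambda>z. enters (x z) (s z))"
  unfolding enters_def
  by (intro computability_intros decidable_ready assms[THEN computable_comp])

lemma decidable_A_stage:
  assumes "computable x" "computable t"
  shows "decidable (\<lambda>z. x z \<in> A_stage (t z))"
  unfolding A_stage_def mem_Collect_eq
  by (intro computability_intros decidable_enters assms[THEN computable_comp])

section \<open>Behaviour of the tests along the stages\<close>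

lemma run_not_None_mono: "run B s c x \<noteq> None \<Longrightarrow> s \<le> t \<Longrightarrow> run B t c x \<noteq> None"
  using run_mono by blast

lemma conv_upto_mono: "conv_upto e x s \<Longrightarrow> s \<le> t \<Longrightarrow> conv_upto e x t"
  unfolding conv_upto_def using run_not_None_mono by blast

lemma eventually_conv_upto:
  assumes "is_total e"
  shows "\<forall>\<^sub>F s in sequentially. conv_upto e x s"
proof -
  have "\<forall>\<^sub>F s in sequentially. run {} s (decode e) z \<noteq> None" for z
  proof -
    obtain s y where "run {} s (decode e) z = Some y"
      using assms unfolding is_total_def converges_def by blast
    then show ?thesis
      unfolding eventually_sequentially using run_not_None_mono by blast
  qed
  then have "\<forall>\<^sub>F s in sequentially. \<forall>z\<in>{..x}. run {} s (decode e) z \<noteq> None"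
    by (intro eventually_ball_finite) auto
  then show ?thesis unfolding conv_upto_def by (simp add: Ball_def)
qed

lemma conv_upto_bounded:
  assumes "\<not> is_total e"
  shows "\<exists>M. \<forall>x s. conv_upto e x s \<longrightarrow> x < M"
proof -
  obtain z where z: "\<And>s. run {} s (decode e) z = None"
    using assms unfolding is_total_def converges_def by fastforce
  have "x < z" if "conv_upto e x s" for x s
    using that z[of s] unfolding conv_upto_def by (metis not_le)
  then show ?thesis by blast
qed

lemma eventually_value_below:
  assumes "is_total e"
  shows "\<forall>\<^sub>F s in sequentially. value_below e r s"
proof -
  obtain s y where y: "run {} s (decode e) r = Some y"
    using assms unfolding is_total_def converges_def by blast
  have "value_below e r t" if "t \<ge> max s (Suc y)" for t
    using run_mono[OF y, of t] that unfolding value_below_def by auto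
  then show ?thesis unfolding eventually_sequentially by blast
qed

lemma eventually_W_stage: "\<forall>\<^sub>F s in sequentially. \<forall>y<u. y \<in> W_stage w s \<longleftrightarrow> y \<in> W w"
proof -
  have "\<forall>\<^sub>F s in sequentially. y \<in> W_stage w s \<longleftrightarrow> y \<in> W w" for y
    using W_stage_mono[of _ _ w] W_iff_stage[of y w] unfolding eventually_sequentially by blast
  then have "\<forall>\<^sub>F s in sequentially. \<forall>y\<in>{..<u}. y \<in> W_stage w s \<longleftrightarrow> y \<in> W w"
    by (intro eventually_ball_finite) auto
  then show ?thesis by (simp add: Ball_def)
qed

lemma computes_cong:
  assumes "\<forall>y<u. y \<in> W_stage w s \<longleftrightarrow> y \<in> W_stage w t"
  shows "computes w c x v u s \<longleftrightarrow> computes w c x v u t"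
  unfolding computes_def truncate_cong[OF assms] ..

lemma eventually_computes:
  assumes "converges (W w) (decode c) x v"
  shows "\<exists>u. \<forall>\<^sub>F s in sequentially. computes w c x v u s"
proof -
  obtain u where u: "prun (truncate (W w) u) u (decode c) x = Some v"
    using converges_prun[OF assms] by blast
  have "\<forall>\<^sub>F s in sequentially. computes w c x v u s"
    using eventually_W_stage[of u w]
    by (rule eventually_mono) (metis u computes_def truncate_cong)
  then show ?thesis by blast
qed

text \<open>Once the three c.e. sets involved have settled below \<open>u\<close>, covering is by
  \<open>W w\<close> and its complement.\<close>

lemma eventually_covers:
  assumes "nce 2 j = - W w"
  shows "\<forall>\<^sub>F s in sequentially. covers w j u s"
proof -
  have "y \<in> W_stage w s \<or> y \<in> nce_stage 2 j s"
    if "y \<in> W_stage w s \<longleftrightarrow> y \<in> W w" "y \<in> W_stage (pfst j) s \<longleftrightarrow> y \<in> W (pfst j)"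
      "y \<in> W_stage (psnd j) s \<longleftrightarrow> y \<in> W (psnd j)" for y s
    using that assms unfolding nce_2 nce_stage_2 by blast
  with eventually_conj[OF eventually_W_stage[of u w]
      eventually_conj[OF eventually_W_stage[of u "pfst j"] eventually_W_stage[of u "psnd j"]]]
  show ?thesis unfolding covers_def by (elim eventually_mono) blast
qed

section \<open>Motion of a witness through its delays\<close>

lemma pos_antimono: "s \<le> t \<Longrightarrow> pfst (pos x t) \<le> pfst (pos x s)"
  by (induction t rule: nat_induct) (auto simp: le_Suc_eq intro: order_trans[OF diff_le_self])

text \<open>The counter begins at \<open>req x + 1\<close> and falls by at most one per stage, so it
  skips no value. The position reached at stage \<open>r + 1\<close> records \<open>r\<close>; this
  shift recurs in the delay arguments.\<close>

lemma pos_passes: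
  assumes "pfst (pos x s) \<le> m" "m \<le> req x"
  obtains r where "r < s" "pfst (pos x r) = Suc m" "pos x (Suc r) = prod_encode (m, r)"
    "advances x r (pos x r)"
proof -
  let ?r = "LEAST r. pfst (pos x (Suc r)) \<le> m"
  have "s \<noteq> 0" using assms by (cases s) auto
  then have ex: "pfst (pos x (Suc (s - 1))) \<le> m" using assms by simp
  then have le: "pfst (pos x (Suc ?r)) \<le> m" by (rule LeastI)
  have "?r \<le> s - 1" using ex by (rule Least_le)
  have gt: "m < pfst (pos x ?r)"
  proof (cases ?r)
    case 0
    then show ?thesis using assms by simp
  next
    case (Suc r)
    then show ?thesis using not_less_Least[of r "\<lambda>r. pfst (pos x (Suc r)) \<le> m"] by simp
  qed
  with le have "advances x ?r (pos x ?r)" by (metis not_le pos.simps(2))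
  with le gt show ?thesis
    using that[of ?r] \<open>?r \<le> s - 1\<close> \<open>s \<noteq> 0\<close> by simp
qed

lemma pos_started:
  assumes "pfst (pos x s) \<le> req x"
  obtains s' u where "s' < s" "pfst (pos x s') = Suc (req x)" "starts x s' u"
proof -
  obtain r where r: "r < s" "pfst (pos x r) = Suc (req x)" "advances x r (pos x r)"
    using pos_passes[OF assms order_refl] by blast
  then obtain u where "starts x r u" unfolding advances_def by auto
  with r that show ?thesis by blast
qed

lemma starts_guess: "starts x s u \<Longrightarrow> e \<in> guess x \<Longrightarrow> e < req x \<and> conv_upto e x s"
  unfolding starts_def using less_of_in_set_decode by blast

lemma ready_started:
  assumes "ready x s"
  obtains s' u where "s' \<le> s" "pfst (pos x s') = Suc (req x)" "starts x s' u"
proof -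
  have "pfst (pos x (Suc s)) \<le> req x" using assms unfolding ready_def by simp
  from pos_started[OF this] show ?thesis using that less_Suc_eq_le by metis
qed

lemma ready_le: "ready x s \<Longrightarrow> x \<le> s"
  by (erule ready_started) (simp add: starts_def)

section \<open>Enumeration of \<open>A_set\<close>\<close>

lemma A_set_iff: "x \<in> A_set \<longleftrightarrow> (\<exists>s. enters x s)"
  unfolding A_set_def A_stage_def by blast

lemma A_stage_mono: "s \<le> t \<Longrightarrow> A_stage s \<subseteq> A_stage t"
  unfolding A_stage_def using order_trans by blast

lemma eventually_A_stage: "\<forall>\<^sub>F t in sequentially. x \<in> A_stage t \<longleftrightarrow> x \<in> A_set"
  using A_stage_mono[THEN subsetD] unfolding eventually_sequentially A_set_def by blast

lemma enters_ready: "enters x s \<Longrightarrow> ready x s"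
  unfolding enters_def by blast

lemma A_stage_subset: "A_stage t \<subseteq> {..t}"
  unfolding A_stage_def using enters_ready ready_le order_trans by blast

lemma computable_enumeration_A: "computable_enumeration A_stage A_set"
proof -
  have "A_stage t = {x. x < Suc t \<and> x \<in> A_stage t}" for t
    using A_stage_subset[of t] by auto
  then have eq: "(\<lambda>t. set_encode (A_stage t)) = (\<lambda>t. set_encode {x. x < Suc t \<and> x \<in> A_stage t})"
    by simp
  have "computable (\<lambda>t. set_encode (A_stage t))"
    unfolding eq by (intro computable_set_encode computability_intros decidable_A_stage)
  moreover have "finite (A_stage t)" for t
    using A_stage_subset finite_subset by blast
  ultimately show ?thesis
    unfolding computable_enumeration_def A_set_def using A_stage_mono by simp
qed

lemma ce_A: "ce A_set"
proof -
  have "decidable (\<lambda>w. enters (pfst w) (psnd w))"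
    by (intro decidable_enters computability_intros)
  from ce_index[OF this] obtain i where "W i = {x. \<exists>s. enters x s}" by blast
  then have "A_set = W i" using A_set_iff by blast
  then show ?thesis unfolding ce_def by blast
qed

text \<open>Of two entering witnesses with the same owner, the earlier one, or the smaller in a tie,
  would be a ready rival that blocks the other.\<close>

lemma inj_on_owner_A: "inj_on owner A_set"
proof (rule inj_onI)
  fix x x' assume "x \<in> A_set" "x' \<in> A_set" and own: "owner x = owner x'"
  then obtain s s' where s: "enters x s" "enters x' s'" unfolding A_set_iff by blast
  have no: "\<not> (t < t' \<or> t = t' \<and> y < y')"
    if "enters y t" "enters y' t'" "owner y = owner y'" for y t y' t'
  proof
    assume less: "t < t' \<or> t = t' \<and> y < y'"
    have "ready y t" using that(1) by (rule enters_ready)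
    moreover have "y \<le> t'" "t \<le> t'" "t < t' \<or> y < y'"
      using ready_le[OF \<open>ready y t\<close>] less by auto
    ultimately show False using that(2,3) unfolding enters_def[of y'] by blast
  qed
  show "x = x'" using no[OF s own] no[OF s(2,1) own[symmetric]] by linarith
qed

text \<open>Among the ready witnesses of an owner, the least one at the earliest stage has no
  rival.\<close>

lemma ready_A:
  assumes "ready x s"
  shows "\<exists>x'\<in>A_set. owner x' = owner x"
proof -
  let ?R = "\<lambda>y t. owner y = owner x \<and> ready y t"
  define t where "t = (LEAST t. \<exists>y. ?R y t)"
  have "\<exists>y. ?R y t" unfolding t_def by (rule LeastI[of _ s]) (use assms in blast)
  then have least: "?R (LEAST y. ?R y t) t" by (rule LeastI_ex)
  define y where "y = (LEAST y. ?R y t)"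
  have R: "?R y t" unfolding y_def by (rule least)
  have "\<not> (s' < t \<or> x' < y)" if "?R x' s'" "s' \<le> t" for x' s'
  proof (cases "s' = t")
    case True
    then show ?thesis using that(1) Least_le[of "\<lambda>y. ?R y t" x'] unfolding y_def by simp
  next
    case False
    then have "s' < t" using that(2) by simp
    then have "\<not> (\<exists>y. ?R y s')" unfolding t_def by (rule not_less_Least)
    then show ?thesis using that(1) by blast
  qed
  then have "\<not> (s' < t \<or> x' < y)" if "owner x' = owner y" "ready x' s'" "s' \<le> t" for x' s'
    using that R by simp
  then have "enters y t" using R unfolding enters_def by blast
  then have "y \<in> A_set" unfolding A_set_iff by blast
  with R show ?thesis by blast
qed

text \<open>The position stays put until the first stage at which it can advance.\<close>

lemma advances_eventually:
  assumes "s \<le> s'" "advances x s' (pos x s)"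
  shows "\<exists>t\<ge>s. pos x t = pos x s \<and> advances x t (pos x t)"
proof -
  let ?t = "LEAST t. s \<le> t \<and> advances x t (pos x s)"
  have t: "s \<le> ?t" "advances x ?t (pos x s)"
    using LeastI[of "\<lambda>t. s \<le> t \<and> advances x t (pos x s)" s'] assms by auto
  have "pos x t = pos x s" if "s \<le> t" "t \<le> ?t" for t
    using that
  proof (induction t rule: dec_induct)
    case (step t)
    then show ?case using not_less_Least[of t "\<lambda>t. s \<le> t \<and> advances x t (pos x s)"] by simp
  qed simp
  from this[of ?t] t show ?thesis by (intro exI[of _ ?t]) simp
qed

text \<open>Only indices below the counter are still waited for, and waiting for a total function
  ends. Because the counter descends, a wrong guess about a larger index does no harm once it has
  been passed.\<close>

lemma pos_completes:
  assumes "pfst (pos x s) \<le> req x" "\<And>e. e \<in> guess x \<Longrightarrow> e < pfst (pos x s) \<Longrightarrow> is_total e"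
  shows "\<exists>t\<ge>s. pfst (pos x t) = 0"
  using assms
proof (induction "pfst (pos x s)" arbitrary: s)
  case 0
  then show ?case by auto
next
  case (Suc e)
  have "\<exists>s'\<ge>s. advances x s' (pos x s)"
  proof (cases "e \<in> guess x")
    case True
    then have "is_total e" using Suc by simp
    from eventually_value_below[OF this, of "psnd (pos x s)"]
    obtain s' where "s' \<ge> s" "value_below e (psnd (pos x s)) s'"
      unfolding eventually_sequentially by (metis nle_le)
    then show ?thesis using Suc.hyps(2)[symmetric] Suc.prems(1)
      by (intro exI[of _ s']) (simp add: advances_def)
  next
    case False
    then show ?thesis using Suc.hyps(2)[symmetric] Suc.prems(1)
      by (intro exI[of _ s]) (simp add: advances_def)
  qed
  then obtain t where "t \<ge> s" "pos x t = pos x s" "advances x t (pos x t)"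
    using advances_eventually by blast
  then have t: "t \<ge> s" "e = pfst (pos x (Suc t))"
    using Suc.hyps(2)[symmetric] by auto
  have "\<exists>t'\<ge>Suc t. pfst (pos x t') = 0"
    by (rule Suc.hyps(1)[OF t(2)]) (use t(2) Suc in auto)
  then show ?case using \<open>t \<ge> s\<close> Suc_leD le_trans by blast
qed

text \<open>To get past the counter \<open>e + 1\<close>, reached at stage \<open>r + 1\<close>, the
  witness had to wait for \<open>\<phi>\<^sub>e(r)\<close>; so it enters at a stage beyond that
  value.\<close>

lemma enters_delay:
  assumes "enters x s" "e \<in> guess x" "e < req x"
  obtains r v where "pfst (pos x (Suc r)) = Suc e" "x \<le> r"
    "converges {} (decode e) r v" "v < s"
proof -
  have "pfst (pos x (Suc s)) \<le> e" using enters_ready[OF assms(1)] unfolding ready_def by simp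
  then obtain r' where r': "r' < Suc s" "pfst (pos x r') = Suc e" "advances x r' (pos x r')"
    using pos_passes[of x "Suc s" e] assms(3) by auto
  then have "pfst (pos x r') \<le> Suc e" "Suc e \<le> req x" using assms(3) by auto
  then obtain r where r: "r < r'" "pos x (Suc r) = prod_encode (Suc e, r)"
    by (rule pos_passes)
  \<comment> \<open>Every change of position lowers the counter, which is still \<open>e + 1\<close>
    at stage \<open>r'\<close>; so the recorded stage is \<open>r\<close> throughout.\<close>
  have "pos x r' = pos x (Suc r)"
  proof -
    have "pos x t = pos x (Suc r)" if "Suc r \<le> t" "t \<le> r'" for t
      using that
    proof (induction t rule: dec_induct)
      case (step t)
      then have "pos x t = pos x (Suc r)" by simp
      moreover have "Suc e \<le> pfst (pos x (Suc t))"
        unfolding r'(2)[symmetric] using step.prems by (intro pos_antimono)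
      ultimately show ?case using r(2) by (auto split: if_splits)
    qed simp
    then show ?thesis using r(1) by simp
  qed
  then have "value_below e r r'"
    using r'(2,3) r(2) assms unfolding advances_def by auto
  moreover have "x \<le> r"
  proof -
    have "pfst (pos x (Suc r)) \<le> req x" using r(2) assms(3) by simp
    then obtain s' u where "s' < Suc r" "starts x s' u" by (rule pos_started)
    then show ?thesis unfolding starts_def by simp
  qed
  ultimately show ?thesis
    using that[of r] r(2) r'(1) unfolding value_below_def converges_def by fastforce
qed

section \<open>The constructed set is 3-tardy\<close>

text \<open>
  \<open>x\<close> has been taken out of the 3-c.e. set for \<open>\<phi>\<^sub>e\<close> that is built under the guess that \<open>G\<close> contains
  exactly the total indices below \<open>e\<close>.
\<close>

definition serves :: "nat \<Rightarrow> nat \<Rightarrow> nat \<Rightarrow> nat \<Rightarrow> bool" where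
  "serves e G x s \<longleftrightarrow> e < req x \<and> e \<in> guess x \<and>
     (\<forall>e'<e. e' \<in> guess x \<longleftrightarrow> e' \<in> set_decode G) \<and> pfst (pos x s) \<le> Suc e"

lemma decidable_serves:
  assumes "computable e" "computable G" "computable x" "computable s"
  shows "decidable (\<lambda>z. serves (e z) (G z) (x z) (s z))"
  unfolding serves_def
  by (intro computability_intros computable_pos assms[THEN computable_comp])

lemma nce_3: "nce 3 e = (W (pfst e) - W (pfst (psnd e))) \<union> W (psnd (psnd e))"
  and nce_stage_3: "nce_stage 3 e s =
    (W_stage (pfst e) s - W_stage (pfst (psnd e)) s) \<union> W_stage (psnd (psnd e)) s"
  by (simp_all add: nce_def nce_stage_def numeral_3_eq_3)

text \<open>A started witness guesses a subset of the numbers below its requirement, so finitely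
  many owners are possible, and each has at most one element in \<open>A_set\<close>.\<close>

lemma finite_early_requirements: "finite {x \<in> A_set. req x \<le> e}"
proof (rule finite_imageD)
  show "inj_on owner {x \<in> A_set. req x \<le> e}"
    using inj_on_owner_A by (rule inj_on_subset) blast
  have "owner ` {x \<in> A_set. req x \<le> e} \<subseteq> prod_encode ` ({..e} \<times> set_encode ` Pow {..<e})"
  proof (intro image_subsetI)
    fix x assume "x \<in> {x \<in> A_set. req x \<le> e}"
    then obtain s where "ready x s" and e: "req x \<le> e" using A_set_iff enters_ready by blast
    then obtain s' u where "starts x s' u" using ready_started by blast
    then have "guess x \<subseteq> {..<e}" using e starts_guess by fastforce
    then have "psnd (owner x) \<in> set_encode ` Pow {..<e}"
      using set_decode_inverse[of "psnd (owner x)"] by (metis PowI image_eqI)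
    moreover have "owner x = prod_encode (req x, psnd (owner x))" by simp
    ultimately show "owner x \<in> prod_encode ` ({..e} \<times> set_encode ` Pow {..<e})"
      using e by (metis SigmaI atMost_iff imageI)
  qed
  then show "finite (owner ` {x \<in> A_set. req x \<le> e})"
    using finite_subset by blast
qed

text \<open>A witness starts only after the guessed indices have converged up to it, and a non-total
  index allows this for finitely many numbers only.\<close>

lemma finite_wrong_guess:
  "finite {x \<in> A_set. \<exists>e'<e. e' \<in> guess x \<and> \<not> is_total e'}"
proof -
  obtain M where M: "\<And>e' x s. \<not> is_total e' \<Longrightarrow> conv_upto e' x s \<Longrightarrow> x < M e'"
    using conv_upto_bounded by metis
  have "{x \<in> A_set. \<exists>e'<e. e' \<in> guess x \<and> \<not> is_total e'} \<subseteq> (\<Union>e'<e. {..<M e'})"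
  proof
    fix x assume "x \<in> {x \<in> A_set. \<exists>e'<e. e' \<in> guess x \<and> \<not> is_total e'}"
    then obtain s e' where "ready x s" and e': "e' < e" "e' \<in> guess x" "\<not> is_total e'"
      using A_set_iff enters_ready by blast
    then obtain s' u where "starts x s' u" using ready_started by blast
    then have "conv_upto e' x s'" using e'(2) starts_guess by blast
    then show "x \<in> (\<Union>e'<e. {..<M e'})" using M e' by blast
  qed
  then show ?thesis using finite_subset by blast
qed

lemma tardy_3_A: "tardy 3 A_set"
  unfolding tardy_def
proof (intro exI[of _ A_stage] conjI allI impI)
  show "computable_enumeration A_stage A_set" by (rule computable_enumeration_A)
next
  fix p assume "computable p \<and> mono p"
  then have p: "computable p" "mono p" by auto
  \<comment> \<open>The pair of \<open>e\<close> and \<open>G\<close> is left as a parameter, since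
    \<open>e\<close> will be an index of a function defined from this enumeration.\<close>
  let ?served = "\<lambda>y s. serves (pfst (pfst y)) (psnd (pfst y)) (psnd y) s"
  have "decidable (\<lambda>w. ?served (pfst w) (psnd w))"
    by (intro decidable_serves computability_intros)
  then obtain i where i: "W i = {y. \<exists>s. ?served y s}" using ce_index[of ?served] by blast
  obtain f where f: "\<And>a. W (f a) = {x. prod_encode (a, x) \<in> W i}"
    and f_stage: "\<And>a x s. prod_encode (a, x) \<in> W_stage i s \<Longrightarrow> x \<in> W_stage (f a) (s + a + 5)"
    using W_section by blast
  \<comment> \<open>By stage \<open>D r\<close> the enumeration of \<open>W i\<close> shows all
    departures up to stage \<open>r + 1\<close>, for all parameters and numbers up to
    \<open>r\<close>.\<close>
  let ?D = "\<lambda>r d. \<forall>a\<le>r. \<forall>x\<le>r. ?served (prod_encode (a, x)) (Suc r) \<longrightarrow>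
    prod_encode (a, x) \<in> W_stage i d"
  define D where "D r = (LEAST d. ?D r d)" for r
  have ex: "\<exists>d. ?D r d" for r
  proof -
    have "finite (prod_encode ` ({..r} \<times> {..r}))" by simp
    then obtain b where b: "\<forall>y\<in>prod_encode ` ({..r} \<times> {..r}). y < b"
      using finite_nat_set_iff_bounded by blast
    obtain d where "\<forall>y<b. y \<in> W_stage i d \<longleftrightarrow> y \<in> W i"
      using eventually_W_stage unfolding eventually_sequentially by blast
    with b have "prod_encode (a, x) \<in> W i \<longrightarrow> prod_encode (a, x) \<in> W_stage i d"
      if "a \<le> r" "x \<le> r" for a x
      using that by blast
    then show ?thesis unfolding i by blast
  qed
  have D: "?D r (D r)" for r unfolding D_def by (rule LeastI_ex[OF ex])
  \<comment> \<open>The summand \<open>r + 5\<close> absorbs the delay \<open>a + 5\<close> from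
    \<open>W_section\<close> as soon as \<open>a \<le> r\<close>.\<close>
  define q where "q r = p (D r + r + 5)" for r
  have "computable D"
    unfolding D_def
    by (rule computable_LEAST[of ?D, OF _ ex])
      (intro computability_intros decidable_serves decidable_W_stage)
  then have "computable q"
    unfolding q_def by (intro computable_comp[OF p(1)] computability_intros)
  then obtain c where c: "\<And>x. converges {} c x (q x)"
    unfolding computable_in_def by blast
  define e where "e = encode c"
  have q: "converges {} (decode e) x (q x)" for x using c unfolding e_def decode_encode .
  have "is_total e" using q unfolding is_total_def by blast
  \<comment> \<open>\<open>F\<close> is the true guess below \<open>e\<close>, and \<open>a\<close>
    the parameter belonging to it.\<close>
  define F where "F = {e'. e' < e \<and> is_total e'}"
  define a where "a = prod_encode (e, set_encode F)"
  have F: "set_decode (set_encode F) = F" unfolding F_def by simp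
  have served: "?served (prod_encode (a, x)) s \<longleftrightarrow> e < req x \<and> e \<in> guess x \<and>
      (\<forall>e'<e. e' \<in> guess x \<longleftrightarrow> is_total e') \<and> pfst (pos x s) \<le> Suc e" for x s
    unfolding serves_def a_def using F by (auto simp: F_def)
  \<comment> \<open>The finitely many exceptions lie below \<open>N\<close>;
    \<open>a \<le> N\<close> will give \<open>a \<le> r\<close> for the stages \<open>r\<close> that
    matter.\<close>
  obtain N where N: "a \<le> N" "\<And>x. x \<in> A_set \<Longrightarrow> N \<le> x \<Longrightarrow>
      e < req x \<and> (\<forall>e'<e. e' \<in> guess x \<longrightarrow> is_total e')"
  proof -
    let ?bad = "{x \<in> A_set. req x \<le> e} \<union> {x \<in> A_set. \<exists>e'<e. e' \<in> guess x \<and> \<not> is_total e'}"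
    have "finite ?bad"
      by (intro finite_UnI finite_early_requirements finite_wrong_guess)
    then obtain N where N: "\<forall>x\<in>?bad. x < N"
      using finite_nat_set_iff_bounded by blast
    have good: "x \<notin> ?bad" if "max a N \<le> x" for x
      by (rule notI, drule bspec[OF N]) (use that in simp)
    show ?thesis
    proof (rule that[of "max a N"])
      show "e < req x \<and> (\<forall>e'<e. e' \<in> guess x \<longrightarrow> is_total e')" if "x \<in> A_set" "max a N \<le> x" for x
        using good[OF that(2)] that(1) by auto
    qed simp
  qed
  \<comment> \<open>Admission waits, with \<open>x\<close> still outside \<open>A_set\<close>, until
    \<open>e\<close> and the indices in \<open>F\<close> have converged up to \<open>x\<close>. If
    \<open>x\<close> enters later, the test in \<open>ready\<close> then forces these indices into
    its guess. Numbers below \<open>N\<close> are settled by the finite set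
    \<open>H\<close>.\<close>
  let ?M1 = "\<lambda>x s. N \<le> x \<and> conv_upto e x s \<and> (\<forall>e'<e. e' \<in> set_decode (set_encode F) \<longrightarrow> conv_upto e' x s) \<and>
    x \<notin> A_stage s"
  define H where "H = set_encode ({..<N} - A_set)"
  let ?M3 = "\<lambda>x s. N \<le> x \<and> pfst (pos x s) = 0 \<and> x \<notin> A_stage s \<or> x \<in> set_decode H"
  have "decidable (\<lambda>w. ?M1 (pfst w) (psnd w))"
    by (intro computability_intros decidable_conv_upto decidable_A_stage)
  then obtain i1 where W_i1: "W i1 = {x. \<exists>s. ?M1 x s}" using ce_index[of ?M1] by blast
  have M1: "?M1 x s \<longleftrightarrow> N \<le> x \<and> conv_upto e x s \<and> (\<forall>e'\<in>F. conv_upto e' x s) \<and> x \<notin> A_stage s" for x s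
    unfolding F by (auto simp: F_def)
  have i1: "W i1 = {x. \<exists>s. N \<le> x \<and> conv_upto e x s \<and> (\<forall>e'\<in>F. conv_upto e' x s) \<and>
      x \<notin> A_stage s}"
    unfolding W_i1 M1 ..
  have "decidable (\<lambda>w. ?M3 (pfst w) (psnd w))"
    by (intro computability_intros computable_pos decidable_A_stage)
  then obtain i3 where i3: "W i3 = {x. \<exists>s. ?M3 x s}" using ce_index[of ?M3] by blast
  have i2: "W (f a) = {x. \<exists>s. ?served (prod_encode (a, x)) s}"
    unfolding f i by simp
  define E where "E = prod_encode (i1, prod_encode (f a, i3))"
  have served_of_enters: "e < req x \<and> e \<in> guess x \<and> (\<forall>e'<e. e' \<in> guess x \<longleftrightarrow> is_total e')"
    if x: "x \<in> W i1" and s: "enters x s" for x s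
  proof -
    obtain s' where s': "N \<le> x" "conv_upto e x s'" "\<forall>e'\<in>F. conv_upto e' x s'" "x \<notin> A_stage s'"
      using x unfolding i1 by blast
    have "s' \<le> s" using s'(4) s unfolding A_stage_def by (rule_tac ccontr) auto
    then have conv: "conv_upto e x s" "\<forall>e'\<in>F. conv_upto e' x s"
      using s'(2,3) conv_upto_mono by blast+
    have "x \<in> A_set" using s A_set_iff by blast
    from N(2)[OF this s'(1)] have *: "e < req x" "\<forall>e'<e. e' \<in> guess x \<longrightarrow> is_total e'" by auto
    have valid: "\<forall>e'<req x. e' \<notin> guess x \<longrightarrow> \<not> conv_upto e' x s"
      using enters_ready[OF s] unfolding ready_def by blast
    have "e' \<in> guess x" if "e' < e" "is_total e'" for e'
    proof -
      have "conv_upto e' x s" using conv(2) that unfolding F_def by blast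
      then show ?thesis using valid that(1) *(1) order.strict_trans by blast
    qed
    moreover have "e \<in> guess x" using valid conv(1) *(1) by blast
    ultimately show ?thesis using * by blast
  qed
  \<comment> \<open>At its entry stage a number still has a nonzero counter, so a counter that
    vanished before entry rules entry out.\<close>
  have i3_A: "x \<notin> A_set" if x: "x \<in> W i3" for x
  proof
    assume "x \<in> A_set"
    then obtain t where t: "enters x t" unfolding A_set_iff by blast
    have "x \<notin> set_decode H" using \<open>x \<in> A_set\<close> unfolding H_def by simp
    then obtain s where s: "pfst (pos x s) = 0" "x \<notin> A_stage s" using x unfolding i3 by blast
    have "s \<le> t" using s(2) t unfolding A_stage_def by (rule_tac ccontr) auto
    then have "pfst (pos x t) = 0" using pos_antimono[of s t x] s(1) by simp
    then show False using enters_ready[OF t] unfolding ready_def by blast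
  qed
  have "nce 3 E = - A_set"
  proof (intro equalityI subsetI)
    fix x assume x: "x \<in> nce 3 E"
    show "x \<in> - A_set"
    proof (cases "x \<in> W i3")
      case True
      then show ?thesis using i3_A by simp
    next
      case False
      then have x: "x \<in> W i1" "x \<notin> W (f a)" using x unfolding nce_3 E_def by auto
      have False if t: "enters x t" for t
      proof -
        have "pfst (pos x (Suc t)) \<le> Suc e" using enters_ready[OF t] unfolding ready_def by simp
        with served_of_enters[OF x(1) t] have "x \<in> W (f a)" unfolding i2 mem_Collect_eq served by blast
        with x(2) show False ..
      qed
      then show ?thesis using A_set_iff by blast
    qed
  next
    fix x assume "x \<in> - A_set"
    then have x: "x \<notin> A_set" "\<And>s. x \<notin> A_stage s" unfolding A_set_def by auto
    show "x \<in> nce 3 E"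
    proof (cases "x < N")
      case True
      then have "x \<in> W i3" using x unfolding i3 H_def by simp
      then show ?thesis unfolding nce_3 E_def by simp
    next
      case False
      have "\<forall>\<^sub>F s in sequentially. conv_upto e x s \<and> (\<forall>e'\<in>F. conv_upto e' x s)"
        using \<open>is_total e\<close>
        by (intro eventually_conj eventually_ball_finite ballI eventually_conv_upto) (auto simp: F_def)
      then obtain s where "conv_upto e x s" "\<forall>e'\<in>F. conv_upto e' x s"
        unfolding eventually_sequentially by blast
      then have i1x: "x \<in> W i1" using False x unfolding i1 by (auto intro!: exI[of _ s])
      show ?thesis
      proof (cases "x \<in> W (f a)")
        case True
        then obtain s where s: "e < req x" "\<forall>e'<e. e' \<in> guess x \<longleftrightarrow> is_total e'" "pfst (pos x s) \<le> Suc e"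
          unfolding i2 mem_Collect_eq served by blast
        \<comment> \<open>A departed number has a correct guess up to \<open>e\<close>, so its
          remaining waits are for total functions and it comes back.\<close>
        have "is_total e'" if "e' \<in> guess x" "e' < pfst (pos x s)" for e'
          using that s \<open>is_total e\<close> by (metis less_SucE order.strict_trans2)
        moreover have "pfst (pos x s) \<le> req x" using s by simp
        ultimately obtain t where "pfst (pos x t) = 0" using pos_completes by blast
        then have "x \<in> W i3" using x False unfolding i3 by (auto intro: exI[of _ t])
        then show ?thesis unfolding nce_3 E_def by simp
      next
        case False
        then show ?thesis using i1x unfolding nce_3 E_def by simp
      qed
    qed
  qed
  moreover have "x \<notin> A_stage (p s)" if x: "x \<in> nce_stage 3 E s" for x s
  proof
    assume A: "x \<in> A_stage (p s)"
    then have "x \<in> A_set" unfolding A_set_def by blast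
    then have "x \<notin> W_stage i3 s" using i3_A W_iff_stage by blast
    then have "x \<in> W_stage i1 s" and i2x: "x \<notin> W_stage (f a) s"
      using x unfolding nce_stage_3 E_def by auto
    then have "x \<in> W i1" using W_iff_stage by blast
    obtain t where t: "t \<le> p s" "enters x t" using A unfolding A_stage_def by blast
    have g: "e < req x \<and> e \<in> guess x \<and> (\<forall>e'<e. e' \<in> guess x \<longleftrightarrow> is_total e')"
      using served_of_enters[OF \<open>x \<in> W i1\<close> t(2)] .
    then obtain r v where r: "pfst (pos x (Suc r)) = Suc e" "x \<le> r"
      "converges {} (decode e) r v" "v < t"
      using enters_delay[OF t(2), of e] by blast
    have "v = q r" using converges_unique[OF r(3) q] .
    have "N \<le> x" using \<open>x \<in> W i1\<close> unfolding i1 by blast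
    then have "a \<le> r" using N(1) r(2) by simp
    have "?served (prod_encode (a, x)) (Suc r)" unfolding served using g r(1) by simp
    then have "prod_encode (a, x) \<in> W_stage i (D r)" using D \<open>a \<le> r\<close> r(2) by blast
    then have "x \<in> W_stage (f a) (D r + a + 5)" by (rule f_stage)
    \<comment> \<open>The departure shows by stage \<open>D r + a + 5\<close> but not at
      \<open>s\<close>, so \<open>p s \<le> q r\<close>; yet \<open>x\<close> entered after
      \<open>q r\<close> and no later than \<open>p s\<close>.\<close>
    then have "\<not> D r + a + 5 \<le> s" using i2x W_stage_mono by blast
    then have "s \<le> D r + r + 5" using \<open>a \<le> r\<close> by simp
    then have "p s \<le> q r" unfolding q_def using p(2) by (rule monoD[rotated])
    then show False using t(1) r(4) \<open>v = q r\<close> by simp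
  qed
  ultimately show "\<exists>e. nce 3 e = - A_set \<and> (\<forall>x s. x \<in> nce_stage 3 e s \<longrightarrow> x \<notin> A_stage (p s))"
    by blast
qed

section \<open>Diagonalization\<close>

text \<open>By \<open>ready_A\<close>, a ready witness would yield a member of \<open>A_set\<close>
  with the same requirement, so it suffices to exclude such members.\<close>

lemma not_entering:
  assumes red: "\<And>x. converges (W w) (decode c) x (chi A_set x)" and "tardy 2 (W w)"
  shows "\<exists>j. nce 2 j = - W w \<and> (\<forall>x s. req x = prod_encode (w, prod_encode (c, j)) \<longrightarrow> \<not> ready x s)"
proof -
  let ?P = "\<lambda>s t. s \<le> t \<and>
    (\<forall>x\<le>s. \<exists>u\<le>t. computes w c x (if x \<in> A_stage t then 1 else 0) u t)"
  have ex: "\<exists>t. ?P s t" for s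
  proof -
    have "\<forall>\<^sub>F t in sequentially. \<exists>u\<le>t. computes w c x (if x \<in> A_stage t then 1 else 0) u t" for x
    proof -
      obtain u where "\<forall>\<^sub>F t in sequentially. computes w c x (chi A_set x) u t"
        using eventually_computes[OF red] by blast
      then show ?thesis
        using eventually_A_stage[of x] eventually_ge_at_top[of u]
        by eventually_elim (auto simp: chi_def)
    qed
    then have "\<forall>\<^sub>F t in sequentially. \<forall>x\<in>{..s}. \<exists>u\<le>t. computes w c x (if x \<in> A_stage t then 1 else 0) u t"
      by (intro eventually_ball_finite) auto
    with eventually_ge_at_top[of s] have "\<forall>\<^sub>F t in sequentially. ?P s t"
      by eventually_elim simp
    then show ?thesis by (rule eventually_happens'[OF sequentially_bot])
  qed
  define p where "p s = (LEAST t. ?P s t)" for s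
  have p: "?P s (p s)" for s unfolding p_def by (rule LeastI_ex[OF ex])
  have "computable p" unfolding p_def
    by (rule computable_LEAST[of ?P, OF _ ex])
      (intro computability_intros decidable_computes decidable_A_stage)
  moreover have "mono p" unfolding p_def
    by (rule mono_Least[OF _ ex]) (meson order_trans)
  ultimately obtain j where j: "nce 2 j = - W w"
    and tardy: "\<And>x s. x \<in> nce_stage 2 j s \<Longrightarrow> x \<notin> W_stage w (p s)"
    using tardy_W_stage[OF assms(2)] by blast
  have False if x: "x \<in> A_set" "req x = prod_encode (w, prod_encode (c, j))" for x
  proof -
    obtain s where s: "enters x s" using x(1) unfolding A_set_iff by blast
    then obtain u where u: "computes w c x 0 u s" "covers w j u s"
      using enters_ready[OF s] x(2) unfolding ready_def by auto
    have "s \<le> p s" using p by blast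
    then have "x \<in> A_stage (p s)" using s unfolding A_stage_def by blast
    moreover have "x \<le> s" using s enters_ready ready_le by blast
    ultimately obtain u' where u': "computes w c x 1 u' (p s)"
      using p[of s] by auto
    \<comment> \<open>The computed value is 0 at stage \<open>s\<close> and 1 at stage
      \<open>p s\<close>, which takes a change of the oracle below the old use
      \<open>u\<close>.\<close>
    have "\<exists>y<u. y \<in> W_stage w (p s) \<and> y \<notin> W_stage w s"
    proof (rule ccontr)
      assume "\<not> ?thesis"
      then have "\<forall>y<u. y \<in> W_stage w s \<longleftrightarrow> y \<in> W_stage w (p s)"
        using W_stage_mono[OF \<open>s \<le> p s\<close>, of w] by blast
      then have "computes w c x 0 u (p s)" using u(1) computes_cong by blast
      with u' show False
        using prun_truncate_unique unfolding computes_def by (metis zero_neq_one)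
    qed
    \<comment> \<open>The new element was in the 2-c.e. set at stage \<open>s\<close>, by the cover,
      and so may not arrive by stage \<open>p s\<close>.\<close>
    then show False using u(2) tardy unfolding covers_def by blast
  qed
  then have "\<not> ready x s" if "req x = prod_encode (w, prod_encode (c, j))" for x s
    using ready_A[of x s] that by metis
  with j show ?thesis by blast
qed

text \<open>Otherwise the attempt would succeed: under a correct guess all delays end, and both the
  computation and the cover by \<open>j\<close> survive until \<open>x\<close> is ready.\<close>

lemma use_changes:
  assumes j: "nce 2 j = - W w"
    and not_ready: "\<And>s. \<not> ready x s"
    and x: "req x = prod_encode (w, prod_encode (c, j))"
    and guess: "\<And>e. e < req x \<Longrightarrow> e \<in> guess x \<longleftrightarrow> is_total e"
    and large: "\<And>e s. e < req x \<Longrightarrow> \<not> is_total e \<Longrightarrow> \<not> conv_upto e x s"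
    and start: "pfst (pos x s) = Suc (req x)" "starts x s u"
  shows "\<exists>y<u. y \<in> W w \<and> y \<notin> W_stage w s"
proof (rule ccontr)
  assume neg: "\<not> ?thesis"
  have "advances x s (pos x s)" using start unfolding advances_def starts_def by auto
  then have "pfst (pos x (Suc s)) = req x" using start(1) by simp
  moreover from this obtain t where t: "Suc s \<le> t" "pfst (pos x t) = 0"
    using pos_completes[of x "Suc s"] guess by auto
  \<comment> \<open>The stage just before the counter first vanishes is the only one at which
    \<open>x\<close> can be ready.\<close>
  define t' where "t' = (LEAST t. pfst (pos x t) = 0)"
  have t': "pfst (pos x t') = 0" unfolding t'_def by (rule LeastI[of _ t]) (rule t)
  have "\<not> t' \<le> s" using pos_antimono[of t' s x] t' start(1) by auto
  then obtain r where r: "t' = Suc r" "s \<le> r" by (cases t') auto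
  have "pfst (pos x r) \<noteq> 0" using not_less_Least[of r "\<lambda>t. pfst (pos x t) = 0"] r(1)
    unfolding t'_def by simp
  moreover have "\<forall>e<req x. e \<notin> guess x \<longrightarrow> \<not> conv_upto e x r" using guess large by blast
  moreover have same: "\<forall>y<u. y \<in> W_stage w s \<longleftrightarrow> y \<in> W_stage w r"
    using neg W_stage_mono[OF r(2), of w] W_iff_stage by blast
  have u: "u \<le> s" "computes w c x 0 u s" "covers w j u s"
    using start(2) x unfolding starts_def by auto
  \<comment> \<open>A number that left the 2-c.e. set would have to lie in \<open>W w\<close>, but
    no new element of \<open>W w\<close> is below \<open>u\<close>.\<close>
  have "covers w j u r"
    unfolding covers_def
  proof (intro allI impI)
    fix y assume "y < u"
    show "y \<in> W_stage w r \<or> y \<in> nce_stage 2 j r"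
    proof (cases "y \<in> W_stage w s")
      case False
      then have "y \<in> nce_stage 2 j s" using u(3) \<open>y < u\<close> unfolding covers_def by blast
      then have "y \<in> W_stage (pfst j) r"
        unfolding nce_stage_2 using W_stage_mono[OF r(2)] by blast
      moreover have "y \<notin> W w" using neg False \<open>y < u\<close> by blast
      then have "y \<notin> W_stage (psnd j) r" using j unfolding nce_2 using W_iff_stage by blast
      ultimately show ?thesis unfolding nce_stage_2 by blast
    qed (use same \<open>y < u\<close> in blast)
  qed
  moreover have "computes w c x 0 u r" using u(2) computes_cong[OF same] by blast
  ultimately have "ready x r"
    using t' r u(1) x unfolding ready_def by (auto intro!: exI[of _ u])
  with not_ready show False ..
qed

theorem theorem2p1:
  "\<exists>A. ce A \<and> tardy 3 A \<and> (\<forall>B. ce B \<and> tardy 2 B \<longrightarrow> \<not> A \<le>\<^sub>T B)"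
proof (intro exI[of _ A_set] conjI allI impI notI)
  show "ce A_set" by (rule ce_A)
  show "tardy 3 A_set" by (rule tardy_3_A)
next
  fix B assume B: "ce B \<and> tardy 2 B" and "A_set \<le>\<^sub>T B"
  then obtain w where w: "B = W w" and tardy: "tardy 2 (W w)" unfolding ce_def by blast
  obtain c' where "\<forall>x. converges B c' x (chi A_set x)"
    using \<open>A_set \<le>\<^sub>T B\<close> unfolding turing_le_def computable_in_def by blast
  then have red: "converges (W w) (decode (encode c')) x (chi A_set x)" for x
    unfolding w decode_encode by blast
  define c where "c = encode c'"
  obtain j where j: "nce 2 j = - W w"
    and no: "\<And>x s. req x = prod_encode (w, prod_encode (c, j)) \<Longrightarrow> \<not> ready x s"
    using not_entering[OF red tardy] unfolding c_def by blast
  define i where "i = prod_encode (w, prod_encode (c, j))"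
  define G where "G = set_encode {e. e < i \<and> is_total e}"
  have G: "set_decode G = {e. e < i \<and> is_total e}" unfolding G_def by simp
  obtain M where M: "\<And>e x s. e < i \<Longrightarrow> \<not> is_total e \<Longrightarrow> conv_upto e x s \<Longrightarrow> x < M"
  proof -
    obtain M where M: "\<And>e x s. \<not> is_total e \<Longrightarrow> conv_upto e x s \<Longrightarrow> x < M e"
      using conv_upto_bounded by metis
    show ?thesis
    proof (rule that)
      fix e x s assume "e < i" "\<not> is_total e" "conv_upto e x s"
      then have "x < M e" "M e \<le> Max (M ` {..<i})" using M by auto
      then show "x < Max (M ` {..<i})" by (rule order.strict_trans2)
    qed
  qed
  \<comment> \<open>One witness for each \<open>k\<close>, all with the correct guess. The last
    component makes \<open>conv_upto\<close> fail for the non-total indices below \<open>i\<close>,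
    and \<open>k \<le> wit k\<close> will bring \<open>k\<close> within the bound in
    \<open>?P\<close>.\<close>
  define wit where "wit k = prod_encode (prod_encode (i, G), prod_encode (k, M))" for k
  have wit: "req (wit k) = i" "guess (wit k) = {e. e < i \<and> is_total e}" "side_of (wit k) = k"
    "k \<le> wit k" "M \<le> wit k" for k
    unfolding wit_def using G le_prod_encode_1[of k M] le_prod_encode_2[of M k]
      le_prod_encode_2[of "prod_encode (k, M)" "prod_encode (i, G)"] by auto
  have changes: "\<exists>y<u. y \<in> W w \<and> y \<notin> W_stage w s"
    if "pfst (pos (wit k) s) = Suc i" "starts (wit k) s u" for k s u
  proof (rule use_changes[OF j])
    show "\<not> ready (wit k) s" for s using no wit(1) unfolding i_def .
    show "req (wit k) = prod_encode (w, prod_encode (c, j))" using wit(1) unfolding i_def .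
    show "\<not> conv_upto e (wit k) s" if "e < req (wit k)" "\<not> is_total e" for e s
      using M[of e "wit k" s] that wit(1,5)[of k] by fastforce
  qed (use that wit in auto)
  \<comment> \<open>By stage \<open>t\<close>, every start up to stage \<open>s\<close> of a witness
    with \<open>k \<le> s\<close> has been answered by a change below its use;
    \<open>changes\<close> makes this wait finite.\<close>
  let ?P = "\<lambda>s t. s \<le> t \<and> (\<forall>k\<le>s. \<forall>s'\<le>s. \<forall>u\<le>s'.
    pfst (pos (wit k) s') = Suc i \<and> starts (wit k) s' u \<longrightarrow>
    (\<exists>y<u. y \<in> W_stage w t \<and> y \<notin> W_stage w s'))"
  have ex: "\<exists>t. ?P s t" for s
  proof -
    have "\<forall>\<^sub>F t in sequentially. \<forall>y<s. y \<in> W_stage w t \<longleftrightarrow> y \<in> W w"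
      by (rule eventually_W_stage)
    with eventually_ge_at_top[of s] have "\<forall>\<^sub>F t in sequentially. ?P s t"
      by eventually_elim (meson changes order.strict_trans2)
    then show ?thesis by (rule eventually_happens'[OF sequentially_bot])
  qed
  define p where "p s = (LEAST t. ?P s t)" for s
  have p: "?P s (p s)" for s unfolding p_def by (rule LeastI_ex[OF ex])
  have "computable p" unfolding p_def wit_def
    by (rule computable_LEAST[OF _ ex[unfolded wit_def]])
      (intro computability_intros computable_pos decidable_starts decidable_W_stage)
  moreover have "mono p" unfolding p_def
    by (rule mono_Least[OF _ ex]) (meson order_trans)
  ultimately obtain k where k: "nce 2 k = - W w"
    and tardy_k: "\<And>x s. x \<in> nce_stage 2 k s \<Longrightarrow> x \<notin> W_stage w (p s)"
    using tardy_W_stage[OF tardy] by blast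
  \<comment> \<open>The correct value at \<open>wit k\<close> is thus 0, and both \<open>j\<close>
    and \<open>k\<close> present the complement of \<open>W w\<close>; hence the starting condition
    holds at all large stages.\<close>
  have "wit k \<notin> A_set" using no wit(1) A_set_iff enters_ready unfolding i_def by blast
  then have "converges (W w) (decode c) (wit k) 0"
    using red[of "wit k"] unfolding c_def by (simp add: chi_def)
  from eventually_computes[OF this] obtain u
    where u: "\<forall>\<^sub>F s in sequentially. computes w c (wit k) 0 u s" ..
  have "\<forall>\<^sub>F s in sequentially. \<forall>e\<in>guess (wit k). conv_upto e (wit k) s"
    using wit(2) by (intro eventually_ball_finite ballI eventually_conv_upto) auto
  with u eventually_covers[OF j, of u] eventually_covers[OF k, of u]
    eventually_ge_at_top[of "max u (wit k)"]
  have "\<forall>\<^sub>F s in sequentially. starts (wit k) s u"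
    by eventually_elim (use wit in \<open>auto simp: starts_def i_def\<close>)
  then obtain s where s: "starts (wit k) s u" "u \<le> s"
    unfolding eventually_sequentially starts_def by blast
  \<comment> \<open>Stage \<open>s\<close> only guarantees that a start occurs; the actual one may
    come at an earlier stage \<open>s'\<close> with another use \<open>u'\<close>.\<close>
  have "pfst (pos (wit k) (Suc s)) \<le> i"
  proof (cases "pfst (pos (wit k) s) = Suc i")
    case True
    then have "advances (wit k) s (pos (wit k) s)" using s wit(1) unfolding advances_def by auto
    then show ?thesis using True by simp
  next
    case False
    have "pfst (pos (wit k) s) \<le> Suc i" using pos_antimono[of 0 s "wit k"] wit(1) by simp
    then show ?thesis using False pos_antimono[of s "Suc s" "wit k"] by linarith
  qed
  then obtain s' u' where s': "pfst (pos (wit k) s') = Suc i" "starts (wit k) s' u'"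
    using pos_started[of "wit k" "Suc s"] wit(1) by metis
  then have "u' \<le> s'" "k \<le> s'" "covers w k u' s'"
    using wit(1,3,4)[of k] unfolding starts_def i_def by auto
  \<comment> \<open>The change that \<open>p\<close> waited for is below \<open>u'\<close>, hence
    was covered by the \<open>k\<close>-th set at stage \<open>s'\<close>, and it arrives too early
    for \<open>p\<close>.\<close>
  then obtain y where "y < u'" "y \<in> W_stage w (p s')" "y \<notin> W_stage w s'"
    using p[of s'] s' by blast
  then show False using \<open>covers w k u' s'\<close> tardy_k unfolding covers_def by blast
qed

end
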